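(* Let $C$ be a compact positive operator on a separable infinite-dimensional space $L^1(M, \mu)$. Then $C$ is a commutator between two positive operators, i.e. there exist positive operators $A$ and $B$ on $L^1(M,\mu)$ such that $C = AB - BA$.
   Context: $L^1(M,\mu)$ is the Banach lattice of integrable functions on a measure space $(M,\mu)$ with the almost-everywhere order. *)

theory Defs
  imports "HOL-Analysis.Analysis"
begin

text \<open>The space \<open>L\<^sup>1(M,\<mu>)\<close> is the set of classes of real integrable functions modulo equality almost
  everywhere; \<open>M :: 'a measure\<close> carries the set, the sigma-algebra and the measure \<open>\<mu>\<close>.
  Everything below is relative to the carrier \<open>L1 M\<close>; values outside it are irrelevant.\<close>

definition L1_rel :: "'a measure \<Rightarrow> (('a \<Rightarrow> real) \<times> ('a \<Rightarrow> real)) set" where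
  "L1_rel M = {(f, g). integrable M f \<and> integrable M g \<and> (AE x in M. f x = g x)}"

definition L1 :: "'a measure \<Rightarrow> ('a \<Rightarrow> real) set set" where
  "L1 M = {f. integrable M f} // L1_rel M"

definition L1_class :: "'a measure \<Rightarrow> ('a \<Rightarrow> real) \<Rightarrow> ('a \<Rightarrow> real) set" where
  "L1_class M f = L1_rel M `` {f}"

definition L1_rep :: "('a \<Rightarrow> real) set \<Rightarrow> 'a \<Rightarrow> real" where
  "L1_rep u = (SOME f. f \<in> u)"

definition L1_zero :: "'a measure \<Rightarrow> ('a \<Rightarrow> real) set" where
  "L1_zero M = L1_class M (\<lambda>x. 0)"

definition L1_add :: "'a measure \<Rightarrow> ('a \<Rightarrow> real) set \<Rightarrow> ('a \<Rightarrow> real) set \<Rightarrow> ('a \<Rightarrow> real) set" where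
  "L1_add M u v = L1_class M (\<lambda>x. L1_rep u x + L1_rep v x)"

definition L1_diff :: "'a measure \<Rightarrow> ('a \<Rightarrow> real) set \<Rightarrow> ('a \<Rightarrow> real) set \<Rightarrow> ('a \<Rightarrow> real) set" where
  "L1_diff M u v = L1_class M (\<lambda>x. L1_rep u x - L1_rep v x)"

definition L1_scale :: "'a measure \<Rightarrow> real \<Rightarrow> ('a \<Rightarrow> real) set \<Rightarrow> ('a \<Rightarrow> real) set" where
  "L1_scale M c u = L1_class M (\<lambda>x. c * L1_rep u x)"

definition L1_lincomb ::
    "'a measure \<Rightarrow> (('a \<Rightarrow> real) set \<Rightarrow> real) \<Rightarrow> ('a \<Rightarrow> real) set set \<Rightarrow> ('a \<Rightarrow> real) set" where
  "L1_lincomb M c S = L1_class M (\<lambda>x. \<Sum>u\<in>S. c u * L1_rep u x)"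

definition L1_norm :: "'a measure \<Rightarrow> ('a \<Rightarrow> real) set \<Rightarrow> real" where
  "L1_norm M u = (\<integral>x. \<bar>L1_rep u x\<bar> \<partial>M)"

definition L1_le :: "'a measure \<Rightarrow> ('a \<Rightarrow> real) set \<Rightarrow> ('a \<Rightarrow> real) set \<Rightarrow> bool" where
  "L1_le M u v \<longleftrightarrow> (AE x in M. L1_rep u x \<le> L1_rep v x)"

definition L1_dist :: "'a measure \<Rightarrow> ('a \<Rightarrow> real) set \<Rightarrow> ('a \<Rightarrow> real) set \<Rightarrow> real" where
  "L1_dist M u v = L1_norm M (L1_diff M u v)"

definition L1_topology :: "'a measure \<Rightarrow> ('a \<Rightarrow> real) set topology" where
  "L1_topology M = Metric_space.mtopology (L1 M) (L1_dist M)"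

definition L1_separable :: "'a measure \<Rightarrow> bool" where
  "L1_separable M \<longleftrightarrow> separable_space (L1_topology M)"

definition L1_infinite_dimensional :: "'a measure \<Rightarrow> bool" where
  "L1_infinite_dimensional M \<longleftrightarrow>
     \<not> (\<exists>S. finite S \<and> S \<subseteq> L1 M \<and> (\<forall>u\<in>L1 M. \<exists>c. u = L1_lincomb M c S))"

definition L1_operator ::
    "'a measure \<Rightarrow> (('a \<Rightarrow> real) set \<Rightarrow> ('a \<Rightarrow> real) set) \<Rightarrow> bool" where
  "L1_operator M T \<longleftrightarrow>
     T \<in> L1 M \<rightarrow> L1 M \<and>
     (\<forall>u\<in>L1 M. \<forall>v\<in>L1 M. T (L1_add M u v) = L1_add M (T u) (T v)) \<and>
     (\<forall>c. \<forall>u\<in>L1 M. T (L1_scale M c u) = L1_scale M c (T u)) \<and>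
     (\<exists>K. \<forall>u\<in>L1 M. L1_norm M (T u) \<le> K * L1_norm M u)"

definition L1_positive_operator ::
    "'a measure \<Rightarrow> (('a \<Rightarrow> real) set \<Rightarrow> ('a \<Rightarrow> real) set) \<Rightarrow> bool" where
  "L1_positive_operator M T \<longleftrightarrow>
     L1_operator M T \<and> (\<forall>u\<in>L1 M. L1_le M (L1_zero M) u \<longrightarrow> L1_le M (L1_zero M) (T u))"

definition L1_compact_operator ::
    "'a measure \<Rightarrow> (('a \<Rightarrow> real) set \<Rightarrow> ('a \<Rightarrow> real) set) \<Rightarrow> bool" where
  "L1_compact_operator M T \<longleftrightarrow>
     L1_operator M T \<and>
     compactin (L1_topology M)
       (L1_topology M closure_of (T ` {u \<in> L1 M. L1_norm M u \<le> 1}))"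

text \<open>The operations do not depend on the chosen representatives, and \<open>L1_dist\<close> is a metric.\<close>

lemma equiv_L1_rel: "equiv {f. integrable M f} (L1_rel M)"
proof (rule equivI)
  show "L1_rel M \<subseteq> {f. integrable M f} \<times> {f. integrable M f}"
    by (auto simp: L1_rel_def)
  show "refl_on {f. integrable M f} (L1_rel M)"
    by (auto simp: L1_rel_def refl_on_def)
  show "sym (L1_rel M)"
    by (auto simp: L1_rel_def sym_def elim: eventually_mono)
  show "trans (L1_rel M)"
    by (auto simp: L1_rel_def trans_def elim!: eventually_elim2)
qed

lemma L1_class_in: "integrable M f \<Longrightarrow> L1_class M f \<in> L1 M"
  by (auto simp: L1_class_def L1_def quotient_def)

lemma L1_class_eq_iff:
  assumes "integrable M f" "integrable M g"
  shows "L1_class M f = L1_class M g \<longleftrightarrow> (AE x in M. f x = g x)"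
  using assms eq_equiv_class_iff[OF equiv_L1_rel, of f M g]
  by (auto simp: L1_class_def L1_rel_def)

lemma L1_rep_class:
  assumes "integrable M f"
  shows "integrable M (L1_rep (L1_class M f))" "AE x in M. L1_rep (L1_class M f) x = f x"
proof -
  have "f \<in> L1_class M f"
    using assms by (auto simp: L1_class_def L1_rel_def)
  then have "L1_rep (L1_class M f) \<in> L1_class M f"
    unfolding L1_rep_def by (rule someI[where P = "\<lambda>g. g \<in> L1_class M f"])
  then show "integrable M (L1_rep (L1_class M f))" "AE x in M. L1_rep (L1_class M f) x = f x"
    by (auto simp: L1_class_def L1_rel_def elim: eventually_mono)
qed

lemma L1_cases:
  assumes "u \<in> L1 M"
  obtains f where "integrable M f" "u = L1_class M f"
  using assms by (auto simp: L1_def L1_class_def elim: quotientE)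

lemma L1_rep:
  assumes "u \<in> L1 M"
  shows "integrable M (L1_rep u)" "L1_class M (L1_rep u) = u"
proof -
  obtain f where f: "integrable M f" "u = L1_class M f"
    using assms by (rule L1_cases)
  show "integrable M (L1_rep u)"
    using L1_rep_class(1)[OF f(1)] f by simp
  then show "L1_class M (L1_rep u) = u"
    using L1_rep_class[OF f(1)] f by (simp add: L1_class_eq_iff)
qed

lemma L1_zero_in: "L1_zero M \<in> L1 M"
  by (simp add: L1_zero_def L1_class_in)

lemma L1_add_in: "u \<in> L1 M \<Longrightarrow> v \<in> L1 M \<Longrightarrow> L1_add M u v \<in> L1 M"
  by (simp add: L1_add_def L1_class_in L1_rep)

lemma L1_diff_in: "u \<in> L1 M \<Longrightarrow> v \<in> L1 M \<Longrightarrow> L1_diff M u v \<in> L1 M"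
  by (simp add: L1_diff_def L1_class_in L1_rep)

lemma L1_scale_in: "u \<in> L1 M \<Longrightarrow> L1_scale M c u \<in> L1 M"
  by (simp add: L1_scale_def L1_class_in L1_rep)

lemma L1_add_class:
  assumes "integrable M f" "integrable M g"
  shows "L1_add M (L1_class M f) (L1_class M g) = L1_class M (\<lambda>x. f x + g x)"
  using L1_rep_class[OF assms(1)] L1_rep_class[OF assms(2)] assms
  by (auto simp: L1_add_def L1_class_eq_iff elim!: eventually_elim2)

lemma L1_diff_class:
  assumes "integrable M f" "integrable M g"
  shows "L1_diff M (L1_class M f) (L1_class M g) = L1_class M (\<lambda>x. f x - g x)"
  using L1_rep_class[OF assms(1)] L1_rep_class[OF assms(2)] assms
  by (auto simp: L1_diff_def L1_class_eq_iff elim!: eventually_elim2)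

lemma L1_scale_class:
  assumes "integrable M f"
  shows "L1_scale M c (L1_class M f) = L1_class M (\<lambda>x. c * f x)"
  using L1_rep_class[OF assms] assms
  by (auto simp: L1_scale_def L1_class_eq_iff elim!: eventually_mono)

lemma L1_norm_class:
  assumes "integrable M f"
  shows "L1_norm M (L1_class M f) = (\<integral>x. \<bar>f x\<bar> \<partial>M)"
  unfolding L1_norm_def using L1_rep_class[OF assms] assms
  by (intro integral_cong_AE) (auto elim!: eventually_mono)

lemma L1_le_class:
  assumes "integrable M f" "integrable M g"
  shows "L1_le M (L1_class M f) (L1_class M g) \<longleftrightarrow> (AE x in M. f x \<le> g x)"
proof -
  have "AE x in M. (L1_rep (L1_class M f) x \<le> L1_rep (L1_class M g) x) = (f x \<le> g x)"
    using L1_rep_class(2)[OF assms(1)] L1_rep_class(2)[OF assms(2)] by eventually_elim simp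
  then show ?thesis
    unfolding L1_le_def by (intro AE_cong_simp eventually_subst) auto
qed

lemma L1_lincomb_empty: "L1_lincomb M c {} = L1_zero M"
  by (simp add: L1_lincomb_def L1_zero_def)

lemma L1_lincomb_insert:
  assumes "finite S" "insert u S \<subseteq> L1 M" "u \<notin> S"
  shows "L1_lincomb M c (insert u S) = L1_add M (L1_scale M (c u) u) (L1_lincomb M c S)"
proof -
  have "integrable M (\<lambda>x. \<Sum>v\<in>S. c v * L1_rep v x)" "integrable M (\<lambda>x. c u * L1_rep u x)"
    using assms by (auto intro!: Bochner_Integration.integrable_sum integrable_mult_right L1_rep)
  then show ?thesis
    using assms by (simp add: L1_lincomb_def L1_scale_def L1_add_class)
qed

lemma Metric_space_L1: "Metric_space (L1 M) (L1_dist M)"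
proof
  fix u v
  show "0 \<le> L1_dist M u v"
    by (simp add: L1_dist_def L1_norm_def)
  let ?h = "\<lambda>x. L1_rep u x - L1_rep v x"
  have swap: "(\<lambda>x. L1_rep v x - L1_rep u x) = (\<lambda>x. - ?h x)"
    by auto
  show "L1_dist M u v = L1_dist M v u"
  proof (cases "integrable M ?h")
    case True
    moreover have "integrable M (\<lambda>x. - ?h x)"
      by (rule Bochner_Integration.integrable_minus[OF True])
    ultimately show ?thesis
      unfolding L1_dist_def L1_diff_def swap
      by (simp only: L1_norm_class abs_minus_cancel)
  next
    case False
    moreover have "\<not> integrable M (\<lambda>x. - ?h x)"
      using False Bochner_Integration.integrable_minus[of M "\<lambda>x. - ?h x"] by auto
    ultimately have "L1_class M ?h = {}" "L1_class M (\<lambda>x. - ?h x) = {}"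
      by (auto simp: L1_class_def L1_rel_def)
    then show ?thesis
      unfolding L1_dist_def L1_diff_def swap by simp
  qed
next
  fix u v assume "u \<in> L1 M" "v \<in> L1 M"
  then obtain f g where fg: "integrable M f" "integrable M g" "u = L1_class M f" "v = L1_class M g"
    by (metis L1_cases)
  then have "L1_dist M u v = (\<integral>x. \<bar>f x - g x\<bar> \<partial>M)"
    by (simp add: L1_dist_def L1_diff_class L1_norm_class)
  moreover have "(\<integral>x. \<bar>f x - g x\<bar> \<partial>M) = 0 \<longleftrightarrow> (AE x in M. \<bar>f x - g x\<bar> = 0)"
    using fg by (intro integral_nonneg_eq_0_iff_AE) auto
  ultimately show "L1_dist M u v = 0 \<longleftrightarrow> u = v"
    using fg by (simp add: L1_class_eq_iff)
next
  fix u v w assume "u \<in> L1 M" "v \<in> L1 M" "w \<in> L1 M"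
  then obtain f g h where fgh: "integrable M f" "integrable M g" "integrable M h"
      "u = L1_class M f" "v = L1_class M g" "w = L1_class M h"
    by (metis L1_cases)
  have "(\<integral>x. \<bar>f x - h x\<bar> \<partial>M) \<le> (\<integral>x. \<bar>f x - g x\<bar> + \<bar>g x - h x\<bar> \<partial>M)"
    using fgh by (intro integral_mono) auto
  also have "\<dots> = (\<integral>x. \<bar>f x - g x\<bar> \<partial>M) + (\<integral>x. \<bar>g x - h x\<bar> \<partial>M)"
    using fgh by (intro Bochner_Integration.integral_add) auto
  finally show "L1_dist M u w \<le> L1_dist M u v + L1_dist M v w"
    using fgh by (simp add: L1_dist_def L1_diff_class L1_norm_class)
qed

end

theory Submission
  imports Defs "HOL-Probability.Weak_Convergence"
begin

text \<open>
  Suppose that \<open>A\<close> and \<open>R\<close> are positive with \<open>A R = I\<close>. Then \<open>B = \<Sum>\<^sub>k R\<^sup>k\<^sup>+\<^sup>1 C A\<^sup>k\<close> is positive whenever it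
  converges, and \<open>A B - B A\<close> telescopes to \<open>C\<close> (\<open>commutator_of_right_inverse\<close>). The proof
  consists in finding \<open>A\<close> and \<open>R\<close> for which the series converges.

  They are weighted shifts along a partition of \<open>M\<close> into pieces \<open>D 0, D 1, \<dots>\<close>: \<open>A\<close> maps functions on
  \<open>D (m + 1)\<close> to functions on \<open>D m\<close>, and \<open>R\<close> goes back. For this it suffices that each \<open>L\<^sup>1(D (m + 1))\<close>
  contains a copy of \<open>L\<^sup>1(D m)\<close> that is the range of a positive contractive projection. With the quadratic weights \<open>sqw\<close>,
  the operators \<open>A\<^sup>k\<close> grow so slowly and the \<open>R\<^sup>k\<close> decay so fast that \<open>B\<close> is bounded as soon as the restriction of
  \<open>C f\<close> to \<open>D m\<close> has norm at most \<open>e m\<close> times that of \<open>f\<close>, with \<open>\<Sum>\<^sub>m sqw m * e m < \<infinity>\<close>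
  (\<open>band_shift.commutator\<close>). The weights are what makes this one-sided condition
  sufficient: a compact operator on \<open>L\<^sup>1\<close>, for instance \<open>f \<mapsto> (\<integral>f) g\<close>, may have the same norm
  on the functions supported in each \<open>D m\<close>.

  Compactness enters here: a compact \<open>C\<close> maps the unit ball to a totally bounded set, so for any
  disjoint sets the restrictions of \<open>C f\<close> tend to \<open>0\<close> uniformly on the ball, and a subsequence
  decays as fast as desired (\<open>tail_small_of_precompact\<close>, \<open>commutator_of_tail_small\<close>).

  It remains to find infinitely many disjoint sets \<open>D n\<close> such that each \<open>L\<^sup>1(D n)\<close> contains a complemented copy of
  the whole space (\<open>disjoint_complemented_copies\<close>). Separability gives a weight \<open>w\<close> and a
  real function \<open>h\<close> that identify \<open>L\<^sup>1(M)\<close> with \<open>L\<^sup>1(\<nu>)\<close> for a Borel probability measure \<open>\<nu>\<close> on the line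
  (\<open>L1_factors_through_line\<close>). If \<open>\<nu>\<close> has a diffuse part, this is cut into infinitely many pieces, and
  distribution and quantile functions map each piece onto \<open>\<nu>\<close>; if \<open>\<nu>\<close> is purely atomic, it has
  infinitely many atoms because the space has infinite dimension, and these are distributed into infinitely many infinite families
  (\<open>spreadable_of_infinite_support\<close>). A map of a reweighted piece onto \<open>\<nu>\<close> induces the embedding by
  composition, and the projection by taking image measures and their densities
  (\<open>weighted_pushforward\<close>).
\<close>

section \<open>Positive operators on integrable functions\<close>

abbreviation L1_nrm :: "'a measure \<Rightarrow> ('a \<Rightarrow> real) \<Rightarrow> real" where
  "L1_nrm M f \<equiv> (\<integral>x. \<bar>f x\<bar> \<partial>M)"

lemma L1_nrm_nonneg: "0 \<le> L1_nrm M f"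
  by simp

lemma L1_nrm_eq_0_iff: "integrable M f \<Longrightarrow> L1_nrm M f = 0 \<longleftrightarrow> (AE x in M. f x = 0)"
  by (subst integral_nonneg_eq_0_iff_AE) auto

lemma L1_nrm_cong: 
  assumes "integrable M f" "integrable M g" "AE x in M. f x = g x"
  shows "L1_nrm M f = L1_nrm M g"
  by (intro integral_cong_AE) (use assms in auto)

lemma L1_nrm_triangle:
  assumes "integrable M f" "integrable M g"
  shows "L1_nrm M (\<lambda>x. f x + g x) \<le> L1_nrm M f + L1_nrm M g"
proof -
  have "L1_nrm M (\<lambda>x. f x + g x) \<le> (\<integral>x. \<bar>f x\<bar> + \<bar>g x\<bar> \<partial>M)"
    using assms by (intro integral_mono) auto
  then show ?thesis using assms by simp
qed

text \<open>A bounded positive operator \<open>L\<^sup>1(M) \<rightarrow> L\<^sup>1(N)\<close>, described by its action on integrable functions, with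
every identity read almost everywhere. With functions instead of classes, infinite series can be
summed pointwise.\<close>

locale positive_L1_map =
  fixes M :: "'a measure" and N :: "'b measure" and K :: real
    and T :: "('a \<Rightarrow> real) \<Rightarrow> 'b \<Rightarrow> real"
  assumes int: "integrable M f \<Longrightarrow> integrable N (T f)"
    and add: "integrable M f \<Longrightarrow> integrable M g \<Longrightarrow> AE y in N. T (\<lambda>x. f x + g x) y = T f y + T g y"
    and scale: "integrable M f \<Longrightarrow> AE y in N. T (\<lambda>x. c * f x) y = c * T f y"
    and pos: "integrable M f \<Longrightarrow> AE x in M. 0 \<le> f x \<Longrightarrow> AE y in N. 0 \<le> T f y"
    and bound: "integrable M f \<Longrightarrow> L1_nrm N (T f) \<le> K * L1_nrm M f"
begin

lemma diff:
  assumes "integrable M f" "integrable M g"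
  shows "AE y in N. T (\<lambda>x. f x - g x) y = T f y - T g y"
proof -
  have "AE y in N. T (\<lambda>x. f x + (-1) * g x) y = T f y + T (\<lambda>x. (-1) * g x) y"
    using assms by (intro add) auto
  moreover have "AE y in N. T (\<lambda>x. (-1) * g x) y = (-1) * T g y"
    using assms by (intro scale) auto
  ultimately show ?thesis by eventually_elim simp
qed

lemma cong:
  assumes "integrable M f" "integrable M g" "AE x in M. f x = g x"
  shows "AE y in N. T f y = T g y"
proof -
  have i: "integrable M (\<lambda>x. f x - g x)" using assms by auto
  have "L1_nrm M (\<lambda>x. f x - g x) = 0"
    using assms(3) i by (subst L1_nrm_eq_0_iff) (auto elim: eventually_mono)
  with bound[OF i] have "L1_nrm N (T (\<lambda>x. f x - g x)) = 0"
    using L1_nrm_nonneg[of N "T (\<lambda>x. f x - g x)"] by simp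
  then have "AE y in N. T (\<lambda>x. f x - g x) y = 0"
    using int[OF i] by (simp add: L1_nrm_eq_0_iff)
  with diff[OF assms(1,2)] show ?thesis by eventually_elim simp
qed

lemma zero: "AE y in N. T (\<lambda>x. 0) y = 0"
  using scale[of "\<lambda>x. 0" 0] by simp

lemma sum:
  fixes n :: nat
  assumes "\<And>k. k < n \<Longrightarrow> integrable M (f k)"
  shows "AE y in N. T (\<lambda>x. \<Sum>k<n. f k x) y = (\<Sum>k<n. T (f k) y)"
  using assms
proof (induction n)
  case (Suc n)
  have "AE y in N. T (\<lambda>x. (\<Sum>k<n. f k x) + f n x) y = T (\<lambda>x. \<Sum>k<n. f k x) y + T (f n) y"
    using Suc.prems by (intro add) auto
  moreover have "AE y in N. T (\<lambda>x. \<Sum>k<n. f k x) y = (\<Sum>k<n. T (f k) y)"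
    by (rule Suc.IH) (use Suc.prems in auto)
  ultimately show ?case by eventually_elim simp
qed (use zero in simp)

end

text \<open>For a positive map the norm bound only has to be tested on nonnegative functions, since
\<open>\<bar>T f\<bar> \<le> T \<bar>f\<bar>\<close> almost everywhere.\<close>

lemma positive_L1_mapI:
  assumes int: "\<And>f. integrable M f \<Longrightarrow> integrable N (T f)"
    and add: "\<And>f g. integrable M f \<Longrightarrow> integrable M g \<Longrightarrow> AE y in N. T (\<lambda>x. f x + g x) y = T f y + T g y"
    and scale: "\<And>f c. integrable M f \<Longrightarrow> AE y in N. T (\<lambda>x. c * f x) y = c * T f y"
    and pos: "\<And>f. integrable M f \<Longrightarrow> AE x in M. 0 \<le> f x \<Longrightarrow> AE y in N. 0 \<le> T f y"
    and bound: "\<And>f. integrable M f \<Longrightarrow> (\<And>x. 0 \<le> f x) \<Longrightarrow> (\<integral>y. T f y \<partial>N) \<le> K * (\<integral>x. f x \<partial>M)"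
  shows "positive_L1_map M N K T"
proof
  fix f :: "'a \<Rightarrow> real" assume f: "integrable M f"
  let ?a = "\<lambda>x. \<bar>f x\<bar>"
  have a: "integrable M ?a" using f by simp
  have "AE y in N. 0 \<le> T (\<lambda>x. ?a x + f x) y" "AE y in N. 0 \<le> T (\<lambda>x. ?a x + (-1) * f x) y"
    using f by (intro pos; auto intro!: AE_I2)+
  moreover have "AE y in N. T (\<lambda>x. ?a x + f x) y = T ?a y + T f y"
    "AE y in N. T (\<lambda>x. ?a x + (-1) * f x) y = T ?a y + T (\<lambda>x. (-1) * f x) y"
    using f by (intro add; auto)+
  moreover have "AE y in N. T (\<lambda>x. (-1) * f x) y = (-1) * T f y"
    using f by (intro scale; auto)
  ultimately have "AE y in N. \<bar>T f y\<bar> \<le> T ?a y" by eventually_elim auto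
  then have "L1_nrm N (T f) \<le> (\<integral>y. T ?a y \<partial>N)"
    using int[OF f] int[OF a] by (intro integral_mono_AE) auto
  also have "\<dots> \<le> K * L1_nrm M f" by (rule bound[OF a]) simp
  finally show "L1_nrm N (T f) \<le> K * L1_nrm M f" .
qed (use assms in auto)

lemma positive_L1_map_comp:
  assumes "positive_L1_map M N K S" "positive_L1_map N P L T" "0 \<le> L"
  shows "positive_L1_map M P (L * K) (\<lambda>f. T (S f))"
proof -
  interpret S: positive_L1_map M N K S by fact
  interpret T: positive_L1_map N P L T by fact
  show ?thesis
  proof
    fix f g :: "'a \<Rightarrow> real" and c assume f: "integrable M f" 
    show "integrable P (T (S f))" by (intro T.int S.int f)
    have "L1_nrm P (T (S f)) \<le> L * L1_nrm N (S f)" by (intro T.bound S.int f)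
    also have "\<dots> \<le> L * (K * L1_nrm M f)" by (intro mult_left_mono S.bound f assms)
    finally show "L1_nrm P (T (S f)) \<le> L * K * L1_nrm M f" by (simp add: mult.assoc)
    have "AE y in P. T (S (\<lambda>x. c * f x)) y = T (\<lambda>x. c * S f x) y"
      by (intro T.cong S.int S.scale f integrable_mult_right)
    moreover have "AE y in P. T (\<lambda>x. c * S f x) y = c * T (S f) y"
      by (intro T.scale S.int f)
    ultimately show "AE y in P. T (S (\<lambda>x. c * f x)) y = c * T (S f) y"
      by eventually_elim simp
    show "AE y in P. 0 \<le> T (S f) y" if "AE x in M. 0 \<le> f x"
      by (intro T.pos S.pos S.int f that)
    assume g: "integrable M g"
    have "AE y in P. T (S (\<lambda>x. f x + g x)) y = T (\<lambda>x. S f x + S g x) y"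
      by (intro T.cong S.int S.add f g Bochner_Integration.integrable_add)
    moreover have "AE y in P. T (\<lambda>x. S f x + S g x) y = T (S f) y + T (S g) y"
      by (intro T.add S.int f g)
    ultimately show "AE y in P. T (S (\<lambda>x. f x + g x)) y = T (S f) y + T (S g) y"
      by eventually_elim simp
  qed
qed

lemma positive_L1_map_id: "positive_L1_map M M 1 (\<lambda>f. f)"
  by standard auto

lemma positive_L1_map_funpow:
  assumes "positive_L1_map M M K T" "0 \<le> K"
  shows "positive_L1_map M M (K ^ n) (T ^^ n)"
proof (induction n)
  case 0
  show ?case using positive_L1_map_id by (simp add: id_def)
next
  case (Suc n)
  show ?case using positive_L1_map_comp[OF Suc assms(1)] assms(2) by (simp add: comp_def)
qed

lemma positive_L1_map_scale:
  assumes "positive_L1_map M N K T" "0 \<le> a"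
  shows "positive_L1_map M N (a * K) (\<lambda>f y. a * T f y)"
proof -
  interpret positive_L1_map M N K T by fact
  show ?thesis
  proof
    fix f g :: "'a \<Rightarrow> real" and c assume f: "integrable M f" 
    show "integrable N (\<lambda>y. a * T f y)" using int[OF f] by simp
    show "L1_nrm N (\<lambda>y. a * T f y) \<le> a * K * L1_nrm M f"
      using mult_left_mono[OF bound[OF f] assms(2)] assms(2) by (simp add: abs_mult mult.assoc)
    show "AE y in N. a * T (\<lambda>x. c * f x) y = c * (a * T f y)"
      using scale[OF f, of c] by eventually_elim simp
    show "AE y in N. 0 \<le> a * T f y" if "AE x in M. 0 \<le> f x"
      using pos[OF f that] by eventually_elim (simp add: assms)
    assume g: "integrable M g"
    show "AE y in N. a * T (\<lambda>x. f x + g x) y = a * T f y + a * T g y"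
      using add[OF f g] by eventually_elim (simp add: algebra_simps)
  qed
qed

text \<open>Absolutely convergent series in \<open>L\<^sup>1\<close> converge pointwise almost everywhere, so a sum of operators can be
defined pointwise on representatives.\<close>

lemma AE_summable_of_summable_nrm:
  fixes f :: "nat \<Rightarrow> 'a \<Rightarrow> real"
  assumes f: "\<And>k. integrable M (f k)" and s: "summable (\<lambda>k. L1_nrm M (f k))"
  shows "AE x in M. summable (\<lambda>k. \<bar>f k x\<bar>)"
proof -
  have [measurable]: "f k \<in> borel_measurable M" for k using f by auto
  have "(\<integral>\<^sup>+x. (\<Sum>k. ennreal \<bar>f k x\<bar>) \<partial>M) = (\<Sum>k. \<integral>\<^sup>+x. ennreal \<bar>f k x\<bar> \<partial>M)"
    by (intro nn_integral_suminf) simp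
  also have "\<dots> = (\<Sum>k. ennreal (L1_nrm M (f k)))"
    using f by (simp add: nn_integral_eq_integral)
  also have "\<dots> = ennreal (\<Sum>k. L1_nrm M (f k))"
    by (rule suminf_ennreal2) (use s in auto)
  finally have "(\<integral>\<^sup>+x. (\<Sum>k. ennreal \<bar>f k x\<bar>) \<partial>M) \<noteq> \<infinity>" by simp
  then have "AE x in M. (\<Sum>k. ennreal \<bar>f k x\<bar>) \<noteq> \<infinity>"
    by (intro nn_integral_PInf_AE) auto
  then show ?thesis
  proof eventually_elim
    case (elim x)
    then show ?case by (intro summable_suminf_not_top) auto
  qed
qed

lemma L1_series:
  fixes f :: "nat \<Rightarrow> 'a \<Rightarrow> real"
  assumes f: "\<And>k. integrable M (f k)" and s: "summable (\<lambda>k. L1_nrm M (f k))"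
  shows "integrable M (\<lambda>x. \<Sum>k. f k x)"
    and "L1_nrm M (\<lambda>x. \<Sum>k. f k x) \<le> (\<Sum>k. L1_nrm M (f k))"
proof -
  have ae: "AE x in M. summable (\<lambda>k. \<bar>f k x\<bar>)"
    by (rule AE_summable_of_summable_nrm[OF f s])
  show i: "integrable M (\<lambda>x. \<Sum>k. f k x)"
    using f ae s by (intro integrable_suminf) auto
  have j: "integrable M (\<lambda>x. \<Sum>k. \<bar>f k x\<bar>)"
    using f ae s by (intro integrable_suminf) auto
  have "L1_nrm M (\<lambda>x. \<Sum>k. f k x) \<le> (\<integral>x. (\<Sum>k. \<bar>f k x\<bar>) \<partial>M)"
    using ae i j by (intro integral_mono_AE) (auto elim!: eventually_mono intro: summable_rabs)
  also have "\<dots> = (\<Sum>k. L1_nrm M (f k))"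
    using f ae s by (intro integral_suminf) auto
  finally show "L1_nrm M (\<lambda>x. \<Sum>k. f k x) \<le> (\<Sum>k. L1_nrm M (f k))" .
qed

lemma L1_series_remainder:
  fixes f :: "nat \<Rightarrow> 'a \<Rightarrow> real"
  assumes f: "\<And>k. integrable M (f k)" and s: "summable (\<lambda>k. L1_nrm M (f k))"
  shows "L1_nrm M (\<lambda>x. (\<Sum>k. f k x) - (\<Sum>k<n. f k x)) \<le> (\<Sum>k. L1_nrm M (f (k + n)))"
proof -
  have s': "summable (\<lambda>k. L1_nrm M (f (k + n)))"
    using s summable_iff_shift[of "\<lambda>k. L1_nrm M (f k)" n] by simp
  have "AE x in M. (\<Sum>k. f k x) - (\<Sum>k<n. f k x) = (\<Sum>k. f (k + n) x)"
    using AE_summable_of_summable_nrm[OF f s]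
  proof eventually_elim
    case (elim x)
    then have "summable (\<lambda>k. f k x)" by (rule summable_rabs_cancel)
    from suminf_split_initial_segment[OF this, of n] show ?case by simp
  qed
  then have "L1_nrm M (\<lambda>x. (\<Sum>k. f k x) - (\<Sum>k<n. f k x)) = L1_nrm M (\<lambda>x. \<Sum>k. f (k + n) x)"
    using f s s' by (intro L1_nrm_cong Bochner_Integration.integrable_diff L1_series(1)
        Bochner_Integration.integrable_sum) auto
  also have "\<dots> \<le> (\<Sum>k. L1_nrm M (f (k + n)))"
    by (rule L1_series(2)[OF f s'])
  finally show ?thesis .
qed

text \<open>Bounded operators commute with absolutely convergent series: the partial sums are respected by
linearity, and both remainders tend to \<open>0\<close> in norm.\<close>

lemma (in positive_L1_map) suminf:
  assumes f: "\<And>k. integrable M (f k)" and s: "summable (\<lambda>k. L1_nrm M (f k))" and "0 \<le> K"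
  shows "summable (\<lambda>k. L1_nrm N (T (f k)))"
    and "AE y in N. T (\<lambda>x. \<Sum>k. f k x) y = (\<Sum>k. T (f k) y)"
proof -
  note Tf = int[OF f]
  have le: "L1_nrm N (T (f k)) \<le> K * L1_nrm M (f k)" for k by (rule bound[OF f])
  show s': "summable (\<lambda>k. L1_nrm N (T (f k)))"
    by (rule summable_comparison_test'[of "\<lambda>k. K * L1_nrm M (f k)" 0]) (use le s in auto)
  let ?F = "\<lambda>x. \<Sum>k. f k x" and ?G = "\<lambda>y. \<Sum>k. T (f k) y"
  have F: "integrable M ?F" by (rule L1_series(1)[OF f s])
  have G: "integrable N ?G" by (rule L1_series(1)[OF Tf s'])
  let ?r = "\<lambda>n. \<Sum>k. L1_nrm M (f (k + n))" and ?r' = "\<lambda>n. \<Sum>k. L1_nrm N (T (f (k + n)))"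
  have est: "L1_nrm N (\<lambda>y. T ?F y - ?G y) \<le> K * ?r n + ?r' n" for n
  proof -
    let ?S = "\<lambda>x. \<Sum>k<n. f k x" and ?S' = "\<lambda>y. \<Sum>k<n. T (f k) y"
    have S: "integrable M ?S" and S': "integrable N ?S'" using f Tf by auto
    have "L1_nrm N (\<lambda>y. T ?F y - ?G y) = L1_nrm N (\<lambda>y. (T ?F y - ?S' y) + (?S' y - ?G y))"
      by simp
    also have "\<dots> \<le> L1_nrm N (\<lambda>y. T ?F y - ?S' y) + L1_nrm N (\<lambda>y. ?S' y - ?G y)"
      using int[OF F] S' G by (intro L1_nrm_triangle) auto
    also have "L1_nrm N (\<lambda>y. ?S' y - ?G y) = L1_nrm N (\<lambda>y. ?G y - ?S' y)"
      by (simp add: abs_minus_commute)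
    also have "\<dots> \<le> ?r' n" by (rule L1_series_remainder[OF Tf s'])
    also have "L1_nrm N (\<lambda>y. T ?F y - ?S' y) = L1_nrm N (T (\<lambda>x. ?F x - ?S x))"
    proof (rule L1_nrm_cong)
      show "AE y in N. T ?F y - ?S' y = T (\<lambda>x. ?F x - ?S x) y"
        using diff[OF F S] sum[of n f, OF f] by eventually_elim simp
    qed (use int F S S' in auto)
    also have "\<dots> \<le> K * L1_nrm M (\<lambda>x. ?F x - ?S x)" using F S by (intro bound) auto
    also have "\<dots> \<le> K * ?r n"
      using assms(3) L1_series_remainder[OF f s] by (intro mult_left_mono) auto
    finally show ?thesis by simp
  qed
  have "(\<lambda>n. K * ?r n + ?r' n) \<longlonglongrightarrow> K * 0 + 0"
    by (intro tendsto_intros suminf_exist_split2 s s')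
  then have "L1_nrm N (\<lambda>y. T ?F y - ?G y) \<le> K * 0 + 0"
    by (rule LIMSEQ_le_const) (use est in auto)
  then have "L1_nrm N (\<lambda>y. T ?F y - ?G y) = 0"
    using L1_nrm_nonneg[of N "\<lambda>y. T ?F y - ?G y"] by linarith
  then have "AE y in N. T ?F y - ?G y = 0"
    using int[OF F] G by (subst (asm) L1_nrm_eq_0_iff) auto
  then show "AE y in N. T ?F y = ?G y" by eventually_elim simp
qed

text \<open>A series of positive operators need not converge in operator norm to have a bounded sum: it is
enough that the norms \<open>\<parallel>T\<^sub>k f\<parallel>\<close> are summable for every single \<open>f\<close>, with a uniform bound.\<close>

lemma positive_L1_map_suminf:
  assumes T: "\<And>k. positive_L1_map M N (L k) (T k)"
    and s: "\<And>f. integrable M f \<Longrightarrow> summable (\<lambda>k. L1_nrm N (T k f))"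
    and le: "\<And>f. integrable M f \<Longrightarrow> (\<Sum>k. L1_nrm N (T k f)) \<le> K * L1_nrm M f"
  shows "positive_L1_map M N K (\<lambda>f y. \<Sum>k. T k f y)"
proof -
  interpret T: positive_L1_map M N "L k" "T k" for k by fact
  have ae: "AE y in N. summable (\<lambda>k. T k f y)" if "integrable M f" for f
    using AE_summable_of_summable_nrm[OF T.int[OF that] s[OF that]]
    by eventually_elim (rule summable_rabs_cancel)
  show ?thesis
  proof
    fix f g :: "'a \<Rightarrow> real" and c assume f: "integrable M f" 
    show "integrable N (\<lambda>y. \<Sum>k. T k f y)" by (intro L1_series(1) T.int f s)
    show "L1_nrm N (\<lambda>y. \<Sum>k. T k f y) \<le> K * L1_nrm M f"
      using L1_series(2)[OF T.int[OF f] s[OF f]] le[OF f] by linarith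
    have "AE y in N. \<forall>k. T k (\<lambda>x. c * f x) y = c * T k f y"
      using T.scale[OF f] by (simp add: AE_all_countable)
    with ae[OF f] show "AE y in N. (\<Sum>k. T k (\<lambda>x. c * f x) y) = c * (\<Sum>k. T k f y)"
      by eventually_elim (simp add: suminf_mult)
    show "AE y in N. 0 \<le> (\<Sum>k. T k f y)" if "AE x in M. 0 \<le> f x"
    proof -
      have "AE y in N. \<forall>k. 0 \<le> T k f y"
        using T.pos[OF f that] by (simp add: AE_all_countable)
      with ae[OF f] show ?thesis by eventually_elim (simp add: suminf_nonneg)
    qed
    assume g: "integrable M g"
    have "AE y in N. \<forall>k. T k (\<lambda>x. f x + g x) y = T k f y + T k g y"
      using T.add[OF f g] by (simp add: AE_all_countable)
    with ae[OF f] ae[OF g] 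
    show "AE y in N. (\<Sum>k. T k (\<lambda>x. f x + g x) y) = (\<Sum>k. T k f y) + (\<Sum>k. T k g y)"
      by eventually_elim (simp add: suminf_add)
  qed
qed

text \<open>The algebraic core. If \<open>A R = I\<close>, then \<open>B = \<Sum>\<^sub>k R\<^sup>k\<^sup>+\<^sup>1 C A\<^sup>k\<close> formally satisfies
\<open>A B = \<Sum>\<^sub>k R\<^sup>k C A\<^sup>k\<close> and \<open>B A = \<Sum>\<^sub>k R\<^sup>k\<^sup>+\<^sup>1 C A\<^sup>k\<^sup>+\<^sup>1\<close>, so that the difference telescopes to \<open>C\<close>. No
subtraction occurs in \<open>B\<close>, hence it inherits positivity from \<open>A\<close>, \<open>R\<close> and \<open>C\<close>. What has to be checked
in an application is the convergence.\<close>

lemma commutator_of_right_inverse: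
  assumes A: "positive_L1_map M M a A" "0 \<le> a"
    and R: "positive_L1_map M M r R" "0 \<le> r"
    and C: "positive_L1_map M M c C" "0 \<le> c"
    and AR: "\<And>f. integrable M f \<Longrightarrow> AE x in M. A (R f) x = f x"
    and s: "\<And>f. integrable M f \<Longrightarrow> summable (\<lambda>k. L1_nrm M ((R ^^ Suc k) (C ((A ^^ k) f))))"
    and le: "\<And>f. integrable M f \<Longrightarrow> (\<Sum>k. L1_nrm M ((R ^^ Suc k) (C ((A ^^ k) f)))) \<le> K * L1_nrm M f"
  shows "\<exists>B. positive_L1_map M M K B \<and>
    (\<forall>f. integrable M f \<longrightarrow> (AE x in M. C f x = A (B f) x - B (A f) x))"
proof (intro exI conjI allI impI)
  define S where "S k f = (R ^^ k) (C ((A ^^ k) f))" for k f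
  define U where "U k f = (R ^^ Suc k) (C ((A ^^ k) f))" for k f
  interpret A: positive_L1_map M M a A by fact
  interpret R: positive_L1_map M M r R by fact
  have S: "positive_L1_map M M (r ^ k * (c * a ^ k)) (S k)" for k
    unfolding S_def
    by (rule positive_L1_map_comp[OF
          positive_L1_map_comp[OF positive_L1_map_funpow[OF A] C]
          positive_L1_map_funpow[OF R] zero_le_power[OF R(2)]])
  have US: "U k f = R (S k f)" for k f by (simp add: U_def S_def)
  have U: "positive_L1_map M M (r * (r ^ k * (c * a ^ k))) (U k)" for k
    unfolding US by (rule positive_L1_map_comp[OF S R])
  interpret S: positive_L1_map M M "r ^ k * (c * a ^ k)" "S k" for k by (rule S)
  interpret U: positive_L1_map M M "r * (r ^ k * (c * a ^ k))" "U k" for k by (rule U)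
  let ?B = "\<lambda>f x. \<Sum>k. U k f x"
  show "positive_L1_map M M K ?B"
    using s le by (intro positive_L1_map_suminf[OF U]) (simp_all add: U_def)
  fix f :: "'a \<Rightarrow> real" assume f: "integrable M f"
  have sU: "summable (\<lambda>k. L1_nrm M (U k f))" using s[OF f] by (simp add: U_def)
  have AU: "AE x in M. A (U k f) x = S k f x" for k
    unfolding US by (rule AR[OF S.int[OF f]])
  have UA: "U k (A f) = S (Suc k) f" for k
    by (simp add: U_def S_def funpow_swap1)
  have "AE x in M. A (?B f) x = (\<Sum>k. A (U k f) x)"
    by (rule A.suminf(2)) (use U.int[OF f] sU A(2) in auto)
  moreover have "AE x in M. \<forall>k. A (U k f) x = S k f x"
    using AU by (simp add: AE_all_countable)
  moreover have "AE x in M. summable (\<lambda>k. \<bar>A (U k f) x\<bar>)"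
    by (rule AE_summable_of_summable_nrm[OF A.int[OF U.int[OF f]] A.suminf(1)[OF U.int[OF f] sU A(2)]])
  ultimately show "AE x in M. C f x = A (?B f) x - ?B (A f) x"
  proof eventually_elim
    case (elim x)
    then have "summable (\<lambda>k. S k f x)" using summable_rabs_cancel by fastforce
    from suminf_split_head[OF this] elim show ?case
      by (simp add: UA) (simp add: S_def)
  qed
qed

section \<open>Weighted shifts along a partition\<close>

text \<open>The projection of \<open>L\<^sup>1\<close> onto the band of functions that vanish off \<open>D\<close>.\<close>

definition band :: "'a set \<Rightarrow> ('a \<Rightarrow> real) \<Rightarrow> 'a \<Rightarrow> real" where
  "band D f x = indicator D x * f x"

lemma positive_L1_map_band:
  assumes "D \<in> sets M"
  shows "positive_L1_map M M 1 (band D)"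
  unfolding band_def[abs_def]
proof
  fix f g :: "'a \<Rightarrow> real" and c assume f: "integrable M f" 
  show i: "integrable M (\<lambda>x. indicator D x * f x)"
    using integrable_mult_indicator[OF assms f] by simp
  show "L1_nrm M (\<lambda>x. indicator D x * f x) \<le> 1 * L1_nrm M f"
    unfolding mult_1_left
    using f i by (intro integral_mono) (auto simp: indicator_def)
qed (auto simp: algebra_simps)

lemma integrable_band: "D \<in> sets M \<Longrightarrow> integrable M f \<Longrightarrow> integrable M (band D f)"
  by (rule positive_L1_map.int[OF positive_L1_map_band])

lemma L1_nrm_band_le: "D \<in> sets M \<Longrightarrow> integrable M f \<Longrightarrow> L1_nrm M (band D f) \<le> L1_nrm M f"
  using positive_L1_map.bound[OF positive_L1_map_band, of D M f] by simp

lemma sum_L1_nrm_band_le: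
  assumes D: "\<And>m. D m \<in> sets M" "disjoint_family D" and f: "integrable M f"
  shows "(\<Sum>m<n::nat. L1_nrm M (band (D m) f)) \<le> L1_nrm M f"
proof -
  have "(\<Sum>m<n. L1_nrm M (band (D m) f)) = (\<integral>x. (\<Sum>m<n. \<bar>band (D m) f x\<bar>) \<partial>M)"
    using integrable_band[OF D(1) f] by (subst Bochner_Integration.integral_sum) auto
  also have "\<dots> \<le> L1_nrm M f"
  proof (rule integral_mono)
    fix x
    have "(\<Sum>m<n. \<bar>band (D m) f x\<bar>) = (\<Sum>m<n. indicator (D m) x) * \<bar>f x\<bar>"
      by (simp add: band_def abs_mult sum_distrib_right)
    also have "(\<Sum>m<n. indicator (D m) x) = (indicator (\<Union>m<n. D m) x :: real)"
      using D(2) by (intro indicator_UN_disjoint[symmetric])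
        (auto simp: disjoint_family_on_def)
    also have "\<dots> * \<bar>f x\<bar> \<le> \<bar>f x\<bar>" by (simp add: indicator_def)
    finally show "(\<Sum>m<n. \<bar>band (D m) f x\<bar>) \<le> \<bar>f x\<bar>" .
  qed (use f integrable_band[OF D(1) f] in auto)
  finally show ?thesis .
qed

lemma summable_L1_nrm_band:
  fixes D :: "nat \<Rightarrow> 'a set"
  assumes D: "\<And>m. D m \<in> sets M" "disjoint_family D" and f: "integrable M f"
  shows "summable (\<lambda>m. L1_nrm M (band (D m) f))"
  by (rule summableI_nonneg_bounded[of _ "L1_nrm M f"])
     (use sum_L1_nrm_band_le[OF assms] in auto)

lemma L1_nrm_eq_suminf_band:
  fixes D :: "nat \<Rightarrow> 'a set"
  assumes D: "\<And>m. D m \<in> sets M" "disjoint_family D" "space M \<subseteq> (\<Union>m. D m)" and f: "integrable M f"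
  shows "L1_nrm M f = (\<Sum>m. L1_nrm M (band (D m) f))"
proof (rule antisym)
  have sm: "summable (\<lambda>m. L1_nrm M (band (D m) f))"
    by (rule summable_L1_nrm_band[OF D(1,2) f])
  have eq: "(\<Sum>m. band (D m) f x) = f x" if x: "x \<in> space M" for x
  proof -
    obtain i where i: "x \<in> D i" using D(3) x by blast
    then have "m \<noteq> i \<Longrightarrow> band (D m) f x = 0" for m
      using D(2) by (auto simp: band_def disjoint_family_on_def indicator_def)
    then have "(\<Sum>m. band (D m) f x) = (\<Sum>m\<in>{i}. band (D m) f x)"
      by (intro suminf_finite) auto
    then show ?thesis using i by (simp add: band_def)
  qed
  have "L1_nrm M f = L1_nrm M (\<lambda>x. \<Sum>m. band (D m) f x)"
    by (rule Bochner_Integration.integral_cong) (use eq in auto)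
  also have "\<dots> \<le> (\<Sum>m. L1_nrm M (band (D m) f))"
    by (rule L1_series(2)[OF integrable_band[OF D(1) f] sm])
  finally show "L1_nrm M f \<le> (\<Sum>m. L1_nrm M (band (D m) f))" .
  show "(\<Sum>m. L1_nrm M (band (D m) f)) \<le> L1_nrm M f"
    by (rule suminf_le_const[OF sm]) (rule sum_L1_nrm_band_le[OF D(1,2) f])
qed

text \<open>The weights for the shift. Two properties are in conflict and quadratic growth reconciles them:
consecutive ratios are bounded, which makes the weighted shift bounded, while the reciprocals
\<open>q n = 1 / sqw n\<close> are stable under convolution, \<open>\<Sum>\<^sub>k q (k + 1) q (j - k) \<le> K q j\<close>. Unweighted shifts,
and geometric weights as well, fail the second condition.\<close>

definition sqw :: "nat \<Rightarrow> real" where "sqw n = (real n + 1)\<^sup>2"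

lemma sqw_pos: "0 < sqw n"
  by (simp add: sqw_def)

lemma sqw_mono: "m \<le> n \<Longrightarrow> sqw m \<le> sqw n"
  by (simp add: sqw_def power_mono)

lemma sqw_Suc_le: "sqw (Suc n) \<le> 4 * sqw n"
  by (simp add: sqw_def power2_eq_square algebra_simps)

lemma inverse_sqw_summable: "summable (\<lambda>n. 1 / sqw n)"
proof -
  have "summable (\<lambda>n. inverse ((real (Suc n))\<^sup>2))"
    using inverse_power_summable[of 2, where 'a=real] by (subst summable_Suc_iff) simp
  then show ?thesis by (simp add: sqw_def inverse_eq_divide add.commute)
qed

text \<open>With \<open>u = k + 2\<close> and \<open>v = j - k + 1\<close> the claim rests on
\<open>(u + v)\<^sup>2 / (u\<^sup>2 v\<^sup>2) \<le> 2 (1 / u\<^sup>2 + 1 / v\<^sup>2)\<close> and the convergence of \<open>\<Sum> 1 / n\<^sup>2\<close>.\<close>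

lemma sqw_convolution:
  obtains K where "0 \<le> K" "\<And>n j. (\<Sum>k<n. if k \<le> j then sqw j / (sqw (Suc k) * sqw (j - k)) else 0) \<le> K"
proof
  define s where "s = (\<Sum>n. 1 / sqw n)"
  have s: "sum (\<lambda>n. 1 / sqw n) B \<le> s" if "finite B" for B
    unfolding s_def using sqw_pos inverse_sqw_summable that by (intro sum_le_suminf) (auto intro: less_imp_le)
  from s[of "{}"] show "0 \<le> 4 * s" by simp
  fix n j
  have term_le: "sqw j / (sqw (Suc k) * sqw (j - k)) \<le> 2 * (1 / sqw (Suc k) + 1 / sqw (j - k))"
    if "k \<le> j" for k
  proof -
    define u v where "u = real k + 2" and "v = real (j - k) + 1"
    have uv: "0 < u" "0 < v" "sqw (Suc k) = u\<^sup>2" "sqw (j - k) = v\<^sup>2" "sqw j \<le> (u + v)\<^sup>2"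
      using that by (auto simp: u_def v_def sqw_def intro!: power_mono)
    have "(u + v)\<^sup>2 \<le> 2 * (u\<^sup>2 + v\<^sup>2)"
      using zero_le_power2[of "u - v"] by (simp add: power2_eq_square algebra_simps)
    with uv(5) have "sqw j / (u\<^sup>2 * v\<^sup>2) \<le> 2 * (u\<^sup>2 + v\<^sup>2) / (u\<^sup>2 * v\<^sup>2)"
      using uv(1,2) by (intro divide_right_mono) auto
    also have "\<dots> = 2 * (1 / u\<^sup>2 + 1 / v\<^sup>2)"
      using uv(1,2) by (simp add: field_simps)
    finally show ?thesis by (simp add: uv)
  qed
  have "(\<Sum>k<n. if k \<le> j then sqw j / (sqw (Suc k) * sqw (j - k)) else 0)
      = (\<Sum>k\<in>{..<n} \<inter> {..j}. sqw j / (sqw (Suc k) * sqw (j - k)))"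
    by (simp add: sum.inter_restrict)
  also have "\<dots> \<le> (\<Sum>k\<in>{..<n} \<inter> {..j}. 2 * (1 / sqw (Suc k) + 1 / sqw (j - k)))"
    by (intro sum_mono term_le) auto
  also have "\<dots> = 2 * ((\<Sum>k\<in>Suc ` ({..<n} \<inter> {..j}). 1 / sqw k) +
                      (\<Sum>k\<in>(\<lambda>k. j - k) ` ({..<n} \<inter> {..j}). 1 / sqw k))"
  proof -
    have "inj_on (\<lambda>k. j - k) ({..<n} \<inter> {..j})" "inj_on Suc ({..<n} \<inter> {..j})"
      by (auto simp: inj_on_def)
    then show ?thesis
      by (simp only: sum_distrib_left[symmetric] sum.distrib sum.reindex o_def)
  qed
  also have "\<dots> \<le> 2 * (s + s)" by (intro mult_left_mono add_mono s) auto
  finally show "(\<Sum>k<n. if k \<le> j then sqw j / (sqw (Suc k) * sqw (j - k)) else 0) \<le> 4 * s" by simp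
qed

text \<open>A partition of the space into \<open>D 0, D 1, \<dots>\<close>, where each \<open>L\<^sup>1(D (m + 1))\<close> contains, via \<open>J m\<close>, a copy of
the whole \<open>L\<^sup>1(M)\<close> that is complemented by the positive contraction \<open>Q m\<close>. In particular it contains a
complemented copy of \<open>L\<^sup>1(D m)\<close>, and these copies allow a shift along the partition. Asking for
complemented copies instead of isomorphisms between the pieces lets \<open>D 0\<close> be of a different kind than the others, for
instance have atoms while the others have none.\<close>

locale band_shift =
  fixes M :: "'a measure" and D :: "nat \<Rightarrow> 'a set" and J Q :: "nat \<Rightarrow> ('a \<Rightarrow> real) \<Rightarrow> 'a \<Rightarrow> real"
  assumes D: "\<And>m. D m \<in> sets M" "disjoint_family D" "space M \<subseteq> (\<Union>m. D m)"
    and J: "\<And>m. positive_L1_map M M 1 (J m)"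
    and Q: "\<And>m. positive_L1_map M M 1 (Q m)"
    and QJ: "\<And>m f. integrable M f \<Longrightarrow> AE x in M. Q m (band (D (Suc m)) (J m f)) x = f x"
begin

abbreviation P :: "nat \<Rightarrow> ('a \<Rightarrow> real) \<Rightarrow> 'a \<Rightarrow> real" where "P m \<equiv> band (D m)"

text \<open>Almost everywhere \<open>down (up f) = f\<close>, so that these two weighted shifts can serve as \<open>A\<close> and \<open>R\<close> above.\<close>

definition down :: "('a \<Rightarrow> real) \<Rightarrow> 'a \<Rightarrow> real" where
  "down f x = (\<Sum>m. sqw (Suc m) / sqw m * P m (Q m (P (Suc m) f)) x)"

definition up :: "('a \<Rightarrow> real) \<Rightarrow> 'a \<Rightarrow> real" where
  "up f x = (\<Sum>m. sqw m / sqw (Suc m) * P (Suc m) (J m (P m f)) x)"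

lemmas P_int = integrable_band[OF D(1)]
lemmas J_int = positive_L1_map.int[OF J]
lemmas Q_int = positive_L1_map.int[OF Q]

lemma ae_bands:
  assumes "\<And>m. AE x in M. P m f x = P m g x"
  shows "AE x in M. f x = g x"
proof -
  have "AE x in M. \<forall>m. P m f x = P m g x" using assms by (simp add: AE_all_countable)
  with AE_space show ?thesis
  proof eventually_elim
    case (elim x)
    with D(3) obtain m where "x \<in> D m" by blast
    with elim(2) show ?case by (auto simp: band_def dest: spec[of _ m])
  qed
qed

lemma D_unique: "x \<in> D m \<Longrightarrow> x \<in> D n \<Longrightarrow> m = n"
  using D(2) by (auto simp: disjoint_family_on_def)

lemma P_down: "P i (down f) = (\<lambda>x. sqw (Suc i) / sqw i * P i (Q i (P (Suc i) f)) x)"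
proof
  fix x
  let ?c = "\<lambda>m. sqw (Suc m) / sqw m" and ?g = "\<lambda>m. Q m (P (Suc m) f)"
  have "(\<Sum>m. ?c m * P m (?g m) x) = (\<Sum>m\<in>{i}. ?c m * P m (?g m) x)" if "x \<in> D i"
    using that by (intro suminf_finite) (auto simp: band_def indicator_def dest: D_unique)
  then show "P i (down f) x = ?c i * P i (?g i) x"
    by (cases "x \<in> D i") (auto simp: band_def down_def)
qed

lemma P_up_Suc: "P (Suc i) (up f) = (\<lambda>x. sqw i / sqw (Suc i) * P (Suc i) (J i (P i f)) x)"
proof
  fix x
  let ?c = "\<lambda>m. sqw m / sqw (Suc m)" and ?g = "\<lambda>m. J m (P m f)"
  have "(\<Sum>m. ?c m * P (Suc m) (?g m) x) = (\<Sum>m\<in>{i}. ?c m * P (Suc m) (?g m) x)" if "x \<in> D (Suc i)"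
    using that by (intro suminf_finite) (auto simp: band_def indicator_def dest: D_unique)
  then show "P (Suc i) (up f) x = ?c i * P (Suc i) (?g i) x"
    by (cases "x \<in> D (Suc i)") (auto simp: band_def up_def)
qed

lemma P_up_0: "P 0 (up f) = (\<lambda>x. 0)"
proof
  fix x
  have "up f x = 0" if "x \<in> D 0"
  proof -
    have "P (Suc m) g x = 0" for m g
      using that by (auto simp: band_def indicator_def dest: D_unique)
    then show ?thesis by (simp add: up_def)
  qed
  then show "P 0 (up f) x = 0" by (auto simp: band_def indicator_def)
qed

lemma L1_nrm_PQ:
  assumes "integrable M f" shows "L1_nrm M (P m (Q m (P n f))) \<le> L1_nrm M (P n f)"
proof -
  have f: "integrable M (P n f)" by (rule P_int[OF assms])
  have "L1_nrm M (P m (Q m (P n f))) \<le> L1_nrm M (Q m (P n f))"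
    by (rule L1_nrm_band_le[OF D(1) Q_int[OF f]])
  also have "\<dots> \<le> 1 * L1_nrm M (P n f)"
    by (rule positive_L1_map.bound[OF Q f])
  finally show ?thesis by (simp only: mult_1_left)
qed

lemma L1_nrm_PJ:
  assumes "integrable M f" shows "L1_nrm M (P n (J m (P m f))) \<le> L1_nrm M (P m f)"
proof -
  have f: "integrable M (P m f)" by (rule P_int[OF assms])
  have "L1_nrm M (P n (J m (P m f))) \<le> L1_nrm M (J m (P m f))"
    by (rule L1_nrm_band_le[OF D(1) J_int[OF f]])
  also have "\<dots> \<le> 1 * L1_nrm M (P m f)"
    by (rule positive_L1_map.bound[OF J f])
  finally show ?thesis by (simp only: mult_1_left)
qed

lemma positive_down: "positive_L1_map M M 4 down"
proof -
  let ?T = "\<lambda>m f x. sqw (Suc m) / sqw m * P m (Q m (P (Suc m) f)) x"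
  have T: "positive_L1_map M M (sqw (Suc m) / sqw m * (1 * (1 * 1))) (?T m)" for m
  proof (rule positive_L1_map_scale)
    show "positive_L1_map M M (1 * (1 * 1)) (\<lambda>f. P m (Q m (P (Suc m) f)))"
      by (rule positive_L1_map_comp[OF
          positive_L1_map_comp[OF positive_L1_map_band[OF D(1)] Q zero_le_one]
          positive_L1_map_band[OF D(1)] zero_le_one])
  qed (use sqw_pos in \<open>simp add: less_imp_le\<close>)
  have le: "L1_nrm M (?T m f) \<le> 4 * L1_nrm M (P (Suc m) f)" if "integrable M f" for m f
  proof -
    have "L1_nrm M (?T m f) = sqw (Suc m) / sqw m * L1_nrm M (P m (Q m (P (Suc m) f)))"
      using sqw_pos by (simp add: abs_mult less_imp_le)
    also have "\<dots> \<le> 4 * L1_nrm M (P (Suc m) f)"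
      using sqw_Suc_le sqw_pos by (intro mult_mono L1_nrm_PQ that) (auto simp: divide_le_eq)
    finally show ?thesis .
  qed
  have sm: "summable (\<lambda>m. L1_nrm M (P (Suc m) f))" if "integrable M f" for f
    using summable_L1_nrm_band[OF D(1,2) that] by (subst summable_Suc_iff)
  have sT: "summable (\<lambda>m. L1_nrm M (?T m f))" if "integrable M f" for f
    by (rule summable_comparison_test'[of "\<lambda>m. 4 * L1_nrm M (P (Suc m) f)" 0])
       (use le sm that in auto)
  show ?thesis unfolding down_def[abs_def]
  proof (rule positive_L1_map_suminf[OF T sT])
    fix f :: "'a \<Rightarrow> real" assume f: "integrable M f"
    have "(\<Sum>m. L1_nrm M (?T m f)) \<le> (\<Sum>m. 4 * L1_nrm M (P (Suc m) f))"
      by (intro suminf_le le sT summable_mult sm f)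
    also have "\<dots> = 4 * (\<Sum>m. L1_nrm M (P (Suc m) f))"
      by (intro suminf_mult sm f)
    also have "(\<Sum>m. L1_nrm M (P (Suc m) f)) \<le> L1_nrm M f"
      using suminf_split_head[OF summable_L1_nrm_band[OF D(1,2) f]]
        L1_nrm_eq_suminf_band[OF D f] by simp
    finally show "(\<Sum>m. L1_nrm M (?T m f)) \<le> 4 * L1_nrm M f" by simp
  qed auto
qed

lemma positive_up: "positive_L1_map M M 1 up"
proof -
  let ?T = "\<lambda>m f x. sqw m / sqw (Suc m) * P (Suc m) (J m (P m f)) x"
  have T: "positive_L1_map M M (sqw m / sqw (Suc m) * (1 * (1 * 1))) (?T m)" for m
  proof (rule positive_L1_map_scale)
    show "positive_L1_map M M (1 * (1 * 1)) (\<lambda>f. P (Suc m) (J m (P m f)))"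
      by (rule positive_L1_map_comp[OF
          positive_L1_map_comp[OF positive_L1_map_band[OF D(1)] J zero_le_one]
          positive_L1_map_band[OF D(1)] zero_le_one])
  qed (use sqw_pos in \<open>simp add: less_imp_le\<close>)
  have le: "L1_nrm M (?T m f) \<le> L1_nrm M (P m f)" if "integrable M f" for m f
  proof -
    have "L1_nrm M (?T m f) = sqw m / sqw (Suc m) * L1_nrm M (P (Suc m) (J m (P m f)))"
      using sqw_pos by (simp add: abs_mult less_imp_le)
    also have "\<dots> \<le> 1 * L1_nrm M (P m f)"
      using sqw_mono[of m "Suc m"] sqw_pos by (intro mult_mono L1_nrm_PJ that) (auto simp: divide_le_eq)
    finally show ?thesis by simp
  qed
  have sm: "summable (\<lambda>m. L1_nrm M (P m f))" if "integrable M f" for f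
    by (rule summable_L1_nrm_band[OF D(1,2) that])
  have sT: "summable (\<lambda>m. L1_nrm M (?T m f))" if "integrable M f" for f
    by (rule summable_comparison_test'[of "\<lambda>m. L1_nrm M (P m f)" 0])
       (use le sm that in auto)
  show ?thesis unfolding up_def[abs_def]
  proof (rule positive_L1_map_suminf[OF T sT])
    fix f :: "'a \<Rightarrow> real" assume f: "integrable M f"
    have "(\<Sum>m. L1_nrm M (?T m f)) \<le> (\<Sum>m. L1_nrm M (P m f))"
      by (intro suminf_le le sT sm f)
    then show "(\<Sum>m. L1_nrm M (?T m f)) \<le> 1 * L1_nrm M f"
      using L1_nrm_eq_suminf_band[OF D f] by simp
  qed auto
qed

lemma down_up:
  assumes f: "integrable M f"
  shows "AE x in M. down (up f) x = f x"
proof (rule ae_bands)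
  fix i
  let ?g = "P (Suc i) (J i (P i f))"
  have g: "integrable M ?g" by (intro P_int J_int f)
  have "AE x in M. Q i (P (Suc i) (up f)) x = sqw i / sqw (Suc i) * Q i ?g x"
    unfolding P_up_Suc by (rule positive_L1_map.scale[OF Q g])
  moreover have "AE x in M. Q i ?g x = P i f x" by (rule QJ[OF P_int[OF f]])
  ultimately show "AE x in M. P i (down (up f)) x = P i f x"
    unfolding P_down
  proof eventually_elim
    case (elim x)
    have "sqw i \<noteq> 0" "sqw (Suc i) \<noteq> 0" using sqw_pos by (metis less_irrefl)+
    with elim show ?case by (simp add: band_def indicator_def)
  qed
qed

lemma down_pow_int: "integrable M f \<Longrightarrow> integrable M ((down ^^ k) f)"
  by (rule positive_L1_map.int[OF positive_L1_map_funpow[OF positive_down]]) auto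

lemma up_pow_int: "integrable M f \<Longrightarrow> integrable M ((up ^^ k) f)"
  by (rule positive_L1_map.int[OF positive_L1_map_funpow[OF positive_up]]) auto

lemma L1_nrm_P_down_pow:
  assumes f: "integrable M f"
  shows "L1_nrm M (P i ((down ^^ k) f)) \<le> sqw (i + k) / sqw i * L1_nrm M (P (i + k) f)"
proof (induction k arbitrary: i)
  case 0
  have "sqw i \<noteq> 0" using sqw_pos by (metis less_irrefl)
  then show ?case by simp
next
  case (Suc k)
  let ?g = "(down ^^ k) f"
  have g: "integrable M ?g" by (rule down_pow_int[OF f])
  have nz: "sqw n \<noteq> 0" for n using sqw_pos by (metis less_irrefl)
  have "L1_nrm M (P i (down ?g)) = sqw (Suc i) / sqw i * L1_nrm M (P i (Q i (P (Suc i) ?g)))"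
    unfolding P_down using sqw_pos by (simp add: abs_mult less_imp_le)
  also have "\<dots> \<le> sqw (Suc i) / sqw i * L1_nrm M (P (Suc i) ?g)"
    using sqw_pos by (intro mult_left_mono L1_nrm_PQ g) (auto intro: less_imp_le)
  also have "\<dots> \<le> sqw (Suc i) / sqw i * (sqw (Suc i + k) / sqw (Suc i) * L1_nrm M (P (Suc i + k) f))"
    using sqw_pos by (intro mult_left_mono Suc.IH) (auto intro: less_imp_le)
  finally show ?case using nz by simp
qed

lemma L1_nrm_P_up_pow:
  assumes f: "integrable M f"
  shows "L1_nrm M (P (i + k) ((up ^^ k) f)) \<le> sqw i / sqw (i + k) * L1_nrm M (P i f)"
proof (induction k)
  case 0
  have "sqw i \<noteq> 0" using sqw_pos by (metis less_irrefl)
  then show ?case by simp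
next
  case (Suc k)
  let ?g = "(up ^^ k) f" and ?n = "i + k"
  have g: "integrable M ?g" by (rule up_pow_int[OF f])
  have nz: "sqw n \<noteq> 0" for n using sqw_pos by (metis less_irrefl)
  have "L1_nrm M (P (Suc ?n) (up ?g)) = sqw ?n / sqw (Suc ?n) * L1_nrm M (P (Suc ?n) (J ?n (P ?n ?g)))"
    unfolding P_up_Suc using sqw_pos by (simp add: abs_mult less_imp_le)
  also have "\<dots> \<le> sqw ?n / sqw (Suc ?n) * L1_nrm M (P ?n ?g)"
    using sqw_pos by (intro mult_left_mono L1_nrm_PJ g) (auto intro: less_imp_le)
  also have "\<dots> \<le> sqw ?n / sqw (Suc ?n) * (sqw i / sqw ?n * L1_nrm M (P i f))"
    using sqw_pos by (intro mult_left_mono Suc.IH) (auto intro: less_imp_le)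
  finally show ?case using nz by simp
qed

lemma P_up_pow_eq_0: "i < k \<Longrightarrow> L1_nrm M (P i ((up ^^ k) f)) = 0" if f: "integrable M f"
proof (induction k arbitrary: i)
  case (Suc k)
  let ?g = "(up ^^ k) f"
  have g: "integrable M ?g" by (rule up_pow_int[OF f])
  show ?case
  proof (cases i)
    case 0
    then show ?thesis by (simp add: P_up_0)
  next
    case (Suc i')
    have "L1_nrm M (P (Suc i') (up ?g)) = sqw i' / sqw (Suc i') * L1_nrm M (P (Suc i') (J i' (P i' ?g)))"
      unfolding P_up_Suc using sqw_pos by (simp add: abs_mult less_imp_le)
    also have "\<dots> \<le> sqw i' / sqw (Suc i') * L1_nrm M (P i' ?g)"
      using sqw_pos by (intro mult_left_mono L1_nrm_PJ g) (auto intro: less_imp_le)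
    also have "\<dots> = 0" using Suc.IH[of i'] Suc Suc.prems by simp
    finally show ?thesis using Suc L1_nrm_nonneg[of M "P (Suc i') (up ?g)"] by simp
  qed
qed simp

text \<open>Powers of \<open>up\<close> decay, at the price of a weighted norm on the right; it is finite on the range of an
operator whose components in the pieces \<open>D i\<close> decay fast.\<close>

lemma L1_nrm_up_pow:
  assumes f: "integrable M f" and s: "summable (\<lambda>i. sqw i * L1_nrm M (P i f))"
  shows "L1_nrm M ((up ^^ k) f) \<le> (1 / sqw k) * (\<Sum>i. sqw i * L1_nrm M (P i f))"
proof -
  let ?g = "(up ^^ k) f"
  have g: "integrable M ?g" by (rule up_pow_int[OF f])
  have sg: "summable (\<lambda>i. L1_nrm M (P i ?g))" by (rule summable_L1_nrm_band[OF D(1,2) g])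
  have "L1_nrm M ?g = (\<Sum>i. L1_nrm M (P i ?g))" by (rule L1_nrm_eq_suminf_band[OF D g])
  also have "\<dots> = (\<Sum>i. L1_nrm M (P (i + k) ?g))"
    using suminf_split_initial_segment[OF sg, of k] P_up_pow_eq_0[OF f] by simp
  also have "\<dots> \<le> (\<Sum>i. 1 / sqw k * (sqw i * L1_nrm M (P i f)))"
  proof (intro suminf_le summable_mult s)
    fix i
    have "sqw i / sqw (i + k) \<le> sqw i / sqw k"
      using sqw_pos sqw_mono[of k "i + k"] by (intro divide_left_mono) (auto intro: less_imp_le)
    then have "sqw i / sqw (i + k) * L1_nrm M (P i f) \<le> sqw i / sqw k * L1_nrm M (P i f)"
      by (intro mult_right_mono) auto
    with L1_nrm_P_up_pow[OF f, of i k]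
    show "L1_nrm M (P (i + k) ?g) \<le> 1 / sqw k * (sqw i * L1_nrm M (P i f))" by simp
    show "summable (\<lambda>i. L1_nrm M (P (i + k) ?g))"
      using summable_iff_shift[of "\<lambda>i. L1_nrm M (P i ?g)" k] sg by simp
  qed
  also have "\<dots> = 1 / sqw k * (\<Sum>i. sqw i * L1_nrm M (P i f))" by (rule suminf_mult[OF s])
  finally show ?thesis .
qed

lemma L1_nrm_down_pow:
  assumes f: "integrable M f"
  shows "summable (\<lambda>j. if k \<le> j then sqw j / sqw (j - k) * L1_nrm M (P j f) else 0)" (is "summable ?h")
    and "L1_nrm M ((down ^^ k) f) \<le> (\<Sum>j. if k \<le> j then sqw j / sqw (j - k) * L1_nrm M (P j f) else 0)"
proof -
  have sf: "summable (\<lambda>i. L1_nrm M (P i f))" by (rule summable_L1_nrm_band[OF D(1,2) f])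
  have ratio: "sqw (i + k) \<le> sqw k * sqw i" for i
  proof -
    have "real i + real k + 1 \<le> (real k + 1) * (real i + 1)" by (simp add: algebra_simps)
    then have "(real i + real k + 1)\<^sup>2 \<le> ((real k + 1) * (real i + 1))\<^sup>2" by (intro power_mono) auto
    then show ?thesis by (simp add: sqw_def power_mult_distrib)
  qed
  have hs: "norm (?h j) \<le> sqw k * L1_nrm M (P j f)" for j
  proof (cases "k \<le> j")
    case True
    have "sqw j / sqw (j - k) \<le> sqw k"
      using ratio[of "j - k"] sqw_pos[of "j - k"] True by (simp add: divide_le_eq)
    then have "sqw j / sqw (j - k) * L1_nrm M (P j f) \<le> sqw k * L1_nrm M (P j f)"
      by (intro mult_right_mono) auto
    then show ?thesis using True sqw_pos by (simp add: less_imp_le)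
  next
    case False
    then show ?thesis using sqw_pos by (simp add: less_imp_le)
  qed
  show sh: "summable ?h"
    by (rule summable_comparison_test'[of "\<lambda>j. sqw k * L1_nrm M (P j f)" 0])
       (use hs sf in \<open>auto intro: summable_mult\<close>)
  let ?g = "(down ^^ k) f"
  have g: "integrable M ?g" by (rule down_pow_int[OF f])
  have sg: "summable (\<lambda>i. L1_nrm M (P i ?g))" by (rule summable_L1_nrm_band[OF D(1,2) g])
  have sh': "summable (\<lambda>i. ?h (i + k))" using summable_iff_shift[of ?h k] sh by blast
  have "L1_nrm M ?g = (\<Sum>i. L1_nrm M (P i ?g))" by (rule L1_nrm_eq_suminf_band[OF D g])
  also have "\<dots> \<le> (\<Sum>i. ?h (i + k))"
    using L1_nrm_P_down_pow[OF f] by (intro suminf_le sg sh') auto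
  also have "\<dots> = (\<Sum>j. ?h j)"
    using suminf_split_initial_segment[OF sh, of k] by simp
  finally show "L1_nrm M ?g \<le> (\<Sum>j. ?h j)" .
qed

text \<open>Powers of \<open>down\<close> grow on the far pieces, but not after averaging with the weights \<open>1 / sqw (k + 1)\<close>:
a function on \<open>D j\<close> contributes \<open>sqw j / (sqw (k + 1) sqw (j - k))\<close> for \<open>k \<le> j\<close> and nothing later, and
the convolution estimate bounds the total independently of \<open>j\<close>.\<close>

lemma sum_L1_nrm_down_pow:
  obtains K where "0 \<le> K"
    "\<And>f n. integrable M f \<Longrightarrow> (\<Sum>k<n. 1 / sqw (Suc k) * L1_nrm M ((down ^^ k) f)) \<le> K * L1_nrm M f"
proof -
  obtain K where K: "0 \<le> K"
    "\<And>n j. (\<Sum>k<n. if k \<le> j then sqw j / (sqw (Suc k) * sqw (j - k)) else 0) \<le> K"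
    by (rule sqw_convolution) blast
  have "(\<Sum>k<n. 1 / sqw (Suc k) * L1_nrm M ((down ^^ k) f)) \<le> K * L1_nrm M f"
    if f: "integrable M f" for f n
  proof -
    let ?h = "\<lambda>k j. if k \<le> j then sqw j / sqw (j - k) * L1_nrm M (P j f) else 0"
    let ?w = "\<lambda>k j. if k \<le> j then sqw j / (sqw (Suc k) * sqw (j - k)) else 0"
    have sf: "summable (\<lambda>i. L1_nrm M (P i f))" by (rule summable_L1_nrm_band[OF D(1,2) f])
    have s1: "summable (\<lambda>j. 1 / sqw (Suc k) * ?h k j)" for k
      by (intro summable_mult L1_nrm_down_pow(1) f)
    have eq: "1 / sqw (Suc k) * ?h k j = ?w k j * L1_nrm M (P j f)" for k j by simp
    have "(\<Sum>k<n. 1 / sqw (Suc k) * L1_nrm M ((down ^^ k) f)) \<le> (\<Sum>k<n. 1 / sqw (Suc k) * (\<Sum>j. ?h k j))"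
      using sqw_pos by (intro sum_mono mult_left_mono L1_nrm_down_pow(2) f) (auto intro: less_imp_le)
    also have "\<dots> = (\<Sum>k<n. \<Sum>j. 1 / sqw (Suc k) * ?h k j)"
      by (intro sum.cong refl suminf_mult[symmetric] L1_nrm_down_pow(1) f)
    also have "\<dots> = (\<Sum>j. \<Sum>k<n. 1 / sqw (Suc k) * ?h k j)"
      by (intro suminf_sum[symmetric] s1)
    also have "\<dots> \<le> (\<Sum>j. K * L1_nrm M (P j f))"
    proof (intro suminf_le summable_sum s1 summable_mult sf)
      fix j
      have "(\<Sum>k<n. 1 / sqw (Suc k) * ?h k j) = (\<Sum>k<n. ?w k j) * L1_nrm M (P j f)"
        unfolding eq by (simp add: sum_distrib_right)
      also have "\<dots> \<le> K * L1_nrm M (P j f)" by (intro mult_right_mono K) auto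
      finally show "(\<Sum>k<n. 1 / sqw (Suc k) * ?h k j) \<le> K * L1_nrm M (P j f)" .
    qed
    also have "\<dots> = K * L1_nrm M f"
      using L1_nrm_eq_suminf_band[OF D f] by (simp add: suminf_mult[OF sf])
    finally show ?thesis .
  qed
  with K(1) show ?thesis by (rule that)
qed

text \<open>The smallness condition is one-sided, on the components of \<open>C f\<close> in the far pieces. On functions
supported in a far piece \<open>C\<close> may keep its full norm, as the rank one operator
\<open>f \<mapsto> (\<integral>f) g\<close> does; the weights of the shifts are there to cope with this.\<close>

lemma commutator:
  assumes C: "positive_L1_map M M c C" "0 \<le> c"
    and e: "\<And>m f. integrable M f \<Longrightarrow> L1_nrm M (P m (C f)) \<le> e m * L1_nrm M f"
    and se: "summable (\<lambda>m. sqw m * e m)" and e0: "\<And>m. 0 \<le> e m"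
  shows "\<exists>A B a b. positive_L1_map M M a A \<and> positive_L1_map M M b B \<and>
    (\<forall>f. integrable M f \<longrightarrow> (AE x in M. C f x = A (B f) x - B (A f) x))"
proof -
  define E where "E = (\<Sum>m. sqw m * e m)"
  have E: "0 \<le> E" unfolding E_def
    by (intro suminf_nonneg se mult_nonneg_nonneg e0 less_imp_le[OF sqw_pos])
  have upC: "L1_nrm M ((up ^^ k) (C f)) \<le> E * (1 / sqw k * L1_nrm M f)" if f: "integrable M f" for f k
  proof -
    have Cf: "integrable M (C f)" by (rule positive_L1_map.int[OF C(1) f])
    have le: "sqw i * L1_nrm M (P i (C f)) \<le> sqw i * e i * L1_nrm M f" for i
      using mult_left_mono[OF e[OF f, of i], of "sqw i"] sqw_pos by (simp add: mult.assoc less_imp_le)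
    have s: "summable (\<lambda>i. sqw i * L1_nrm M (P i (C f)))"
      by (rule summable_comparison_test'[of "\<lambda>i. sqw i * e i * L1_nrm M f" 0])
         (use le se sqw_pos in \<open>auto intro: summable_mult2 simp: less_imp_le abs_mult\<close>)
    have "(\<Sum>i. sqw i * L1_nrm M (P i (C f))) \<le> (\<Sum>i. sqw i * e i * L1_nrm M f)"
      by (intro suminf_le le s summable_mult2 se)
    also have "\<dots> = E * L1_nrm M f" unfolding E_def by (intro suminf_mult2[symmetric] se)
    finally have "1 / sqw k * (\<Sum>i. sqw i * L1_nrm M (P i (C f))) \<le> 1 / sqw k * (E * L1_nrm M f)"
      using sqw_pos by (intro mult_left_mono) (auto intro: less_imp_le)
    with L1_nrm_up_pow[OF Cf s, of k] show ?thesis by (simp add: mult_ac)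
  qed
  obtain K where K: "0 \<le> K"
    "\<And>f n. integrable M f \<Longrightarrow> (\<Sum>k<n. 1 / sqw (Suc k) * L1_nrm M ((down ^^ k) f)) \<le> K * L1_nrm M f"
    by (rule sum_L1_nrm_down_pow) blast
  have part: "(\<Sum>k<n. L1_nrm M ((up ^^ Suc k) (C ((down ^^ k) f)))) \<le> E * K * L1_nrm M f"
    if f: "integrable M f" for f n
  proof -
    have "(\<Sum>k<n. L1_nrm M ((up ^^ Suc k) (C ((down ^^ k) f))))
        \<le> (\<Sum>k<n. E * (1 / sqw (Suc k) * L1_nrm M ((down ^^ k) f)))"
      by (intro sum_mono upC down_pow_int f)
    also have "\<dots> \<le> E * (K * L1_nrm M f)"
      unfolding sum_distrib_left[symmetric] by (intro mult_left_mono K f E)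
    finally show ?thesis by (simp add: mult_ac)
  qed
  have s: "summable (\<lambda>k. L1_nrm M ((up ^^ Suc k) (C ((down ^^ k) f))))" if "integrable M f" for f
    by (rule summableI_nonneg_bounded[OF _ part[OF that]]) simp
  have le: "(\<Sum>k. L1_nrm M ((up ^^ Suc k) (C ((down ^^ k) f)))) \<le> E * K * L1_nrm M f"
    if "integrable M f" for f
    by (rule suminf_le_const[OF s[OF that] part[OF that]])
  obtain B where "positive_L1_map M M (E * K) B"
    "\<And>f. integrable M f \<Longrightarrow> AE x in M. C f x = down (B f) x - B (down f) x"
    using commutator_of_right_inverse[OF positive_down _ positive_up _ C down_up s le] by auto
  with positive_down show ?thesis by blast
qed

end

section \<open>Compact operators and disjoint sets\<close>

text \<open>After passing to a subsequence of the given sets the components of \<open>C f\<close> are as small as desired;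
the complement of the chosen sets becomes the zeroth piece of the partition.\<close>

lemma commutator_of_tail_small:
  assumes D: "\<And>n::nat. D n \<in> sets M" "disjoint_family D"
    and J: "\<And>n. positive_L1_map M M 1 (J n)" and Q: "\<And>n. positive_L1_map M M 1 (Q n)"
    and QJ: "\<And>n f. integrable M f \<Longrightarrow> AE x in M. Q n (band (D n) (J n f)) x = f x"
    and C: "positive_L1_map M M c C" "0 \<le> c"
    and small: "\<And>e. 0 < e \<Longrightarrow> \<exists>N. \<forall>n\<ge>N. \<forall>f. integrable M f \<longrightarrow> L1_nrm M (band (D n) (C f)) \<le> e * L1_nrm M f"
  shows "\<exists>A B a b. positive_L1_map M M a A \<and> positive_L1_map M M b B \<and>
    (\<forall>f. integrable M f \<longrightarrow> (AE x in M. C f x = A (B f) x - B (A f) x))"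
proof -
  \<comment> \<open>This choice makes \<open>sqw m * e m = 1 / sqw m\<close> summable.\<close>
  define e where "e m = 1 / (sqw m)\<^sup>2" for m
  have e: "0 < e m" for m using sqw_pos[of m] by (simp add: e_def)
  have "\<forall>m. \<exists>N. \<forall>n\<ge>N. \<forall>f. integrable M f \<longrightarrow> L1_nrm M (band (D n) (C f)) \<le> e (Suc m) * L1_nrm M f"
    using small[OF e] by blast
  then obtain N where N: "\<And>m n f. N m \<le> n \<Longrightarrow> integrable M f \<Longrightarrow>
      L1_nrm M (band (D n) (C f)) \<le> e (Suc m) * L1_nrm M f" by metis
  define r where "r m = (\<Sum>i\<le>m. N i) + m" for m
  have rN: "N m \<le> r m" for m unfolding r_def by (rule trans_le_add1) (auto intro: member_le_sum)
  have "strict_mono r" unfolding r_def by (rule strict_monoI_Suc) simp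
  then have inj: "inj r" by (rule strict_mono_imp_inj_on)
  define E where "E m = (case m of 0 \<Rightarrow> space M - (\<Union>i. D (r i)) | Suc i \<Rightarrow> D (r i))" for m
  interpret band_shift M E "\<lambda>m. J (r m)" "\<lambda>m. Q (r m)"
  proof (rule band_shift.intro)
    show "E m \<in> sets M" for m using D(1) by (auto simp: E_def split: nat.split)
    show "disjoint_family E"
      unfolding disjoint_family_on_def
    proof (intro ballI impI)
      fix m n :: nat assume mn: "m \<noteq> n"
      have "D (r i) \<inter> D (r j) = {}" if "i \<noteq> j" for i j
        using D(2) inj that by (auto simp: disjoint_family_on_def inj_eq)
      with mn show "E m \<inter> E n = {}" by (cases m; cases n) (auto simp: E_def)
    qed
    show "space M \<subseteq> (\<Union>m. E m)"
    proof
      fix x assume "x \<in> space M"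
      then have "x \<in> E 0 \<or> (\<exists>i. x \<in> E (Suc i))" by (auto simp: E_def)
      then show "x \<in> (\<Union>m. E m)" by blast
    qed
    show "AE x in M. Q (r m) (band (E (Suc m)) (J (r m) f)) x = f x" if "integrable M f" for m f
      using QJ[OF that, of "r m"] by (simp add: E_def)
  qed (rule J Q)+
  define e' where "e' m = (case m of 0 \<Rightarrow> c | Suc i \<Rightarrow> e (Suc i))" for m
  show ?thesis
  proof (rule commutator[OF C])
    fix m and f :: "'a \<Rightarrow> real" assume f: "integrable M f"
    show "L1_nrm M (band (E m) (C f)) \<le> e' m * L1_nrm M f"
    proof (cases m)
      case 0
      have "L1_nrm M (band (E 0) (C f)) \<le> L1_nrm M (C f)"
        by (rule L1_nrm_band_le[OF local.D(1) positive_L1_map.int[OF C(1) f]])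
      also have "\<dots> \<le> c * L1_nrm M f" by (rule positive_L1_map.bound[OF C(1) f])
      finally show ?thesis using 0 by (simp add: e'_def)
    next
      case (Suc i)
      then show ?thesis using N[OF rN f] by (simp add: e'_def E_def)
    qed
  next
    show "summable (\<lambda>m. sqw m * e' m)"
    proof (subst summable_Suc_iff[symmetric])
      have "sqw (Suc m) * e' (Suc m) = 1 / sqw (Suc m)" for m
        using sqw_pos[of "Suc m"] by (simp add: e'_def e_def power2_eq_square)
      then show "summable (\<lambda>m. sqw (Suc m) * e' (Suc m))"
        using inverse_sqw_summable by (simp only: summable_Suc_iff[of "\<lambda>m. 1 / sqw m"])
    qed
    show "0 \<le> e' m" for m using C(2) e by (auto simp: e'_def less_imp_le split: nat.split)
  qed
qed

text \<open>For a single \<open>g\<close> the norms on disjoint sets are summable, hence tend to \<open>0\<close>; a finite net of the image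
of the unit ball makes this uniform.\<close>

lemma tail_small_of_precompact:
  assumes D: "\<And>n::nat. D n \<in> sets M" "disjoint_family D"
    and C: "positive_L1_map M M c C"
    and tb: "\<And>e. 0 < e \<Longrightarrow> \<exists>G. finite G \<and> (\<forall>g\<in>G. integrable M g) \<and>
        (\<forall>f. integrable M f \<longrightarrow> L1_nrm M f \<le> 1 \<longrightarrow> (\<exists>g\<in>G. L1_nrm M (\<lambda>x. C f x - g x) \<le> e))"
    and e: "0 < e"
  shows "\<exists>N. \<forall>n\<ge>N. \<forall>f. integrable M f \<longrightarrow> L1_nrm M (band (D n) (C f)) \<le> e * L1_nrm M f"
proof -
  interpret C: positive_L1_map M M c C by fact
  obtain G where G: "finite G" "\<And>g. g \<in> G \<Longrightarrow> integrable M g"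
    "\<And>f. integrable M f \<Longrightarrow> L1_nrm M f \<le> 1 \<Longrightarrow> \<exists>g\<in>G. L1_nrm M (\<lambda>x. C f x - g x) \<le> e / 2"
    using tb[of "e / 2"] e by auto
  have "eventually (\<lambda>n. \<forall>g\<in>G. L1_nrm M (band (D n) g) < e / 2) sequentially"
  proof (rule eventually_ball_finite[OF G(1)], rule ballI)
    fix g assume "g \<in> G"
    from summable_L1_nrm_band[OF D G(2)[OF this]]
    have "(\<lambda>n. L1_nrm M (band (D n) g)) \<longlonglongrightarrow> 0" by (rule summable_LIMSEQ_zero)
    then show "eventually (\<lambda>n. L1_nrm M (band (D n) g) < e / 2) sequentially"
      using e by (intro order_tendstoD(2)) auto
  qed
  then obtain N where N: "\<And>n g. N \<le> n \<Longrightarrow> g \<in> G \<Longrightarrow> L1_nrm M (band (D n) g) < e / 2"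
    by (auto simp: eventually_sequentially)
  have unit: "L1_nrm M (band (D n) (C f)) \<le> e" if f: "integrable M f" "L1_nrm M f \<le> 1" and n: "N \<le> n" for f n
  proof -
    obtain g where g: "g \<in> G" "L1_nrm M (\<lambda>x. C f x - g x) \<le> e / 2" using G(3)[OF f] by blast
    note ig = G(2)[OF g(1)] and iC = C.int[OF f(1)]
    have d: "integrable M (\<lambda>x. C f x - g x)" using ig iC by auto
    have "L1_nrm M (band (D n) (C f)) = L1_nrm M (\<lambda>x. band (D n) (\<lambda>x. C f x - g x) x + band (D n) g x)"
      by (simp add: band_def algebra_simps)
    also have "\<dots> \<le> L1_nrm M (band (D n) (\<lambda>x. C f x - g x)) + L1_nrm M (band (D n) g)"
      by (intro L1_nrm_triangle integrable_band D d ig)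
    also have "\<dots> \<le> e / 2 + e / 2"
      using L1_nrm_band_le[OF D(1) d, of n] g(2) N[OF n g(1)] by linarith
    finally show ?thesis by simp
  qed
  show ?thesis
  proof (intro exI allI impI)
    fix n and f :: "'a \<Rightarrow> real" assume n: "N \<le> n" and f: "integrable M f"
    let ?c = "L1_nrm M f"
    show "L1_nrm M (band (D n) (C f)) \<le> e * ?c"
    proof (cases "?c = 0")
      case True
      then show ?thesis
        using L1_nrm_band_le[OF D(1) C.int[OF f], of n] C.bound[OF f] by simp
    next
      case False
      then have c: "0 < ?c" using L1_nrm_nonneg[of M f] by linarith
      let ?f = "\<lambda>x. inverse ?c * f x"
      have iC: "integrable M (band (D n) (C f))" by (intro integrable_band D C.int f)
      have "L1_nrm M ?f = inverse ?c * ?c" using c by (simp add: abs_mult)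
      then have "L1_nrm M (band (D n) (C ?f)) \<le> e"
        using c f n by (intro unit) auto
      moreover have "L1_nrm M (band (D n) (C ?f)) = L1_nrm M (\<lambda>x. inverse ?c * band (D n) (C f) x)"
      proof (rule L1_nrm_cong)
        show "integrable M (band (D n) (C ?f))" using f by (intro integrable_band D C.int) auto
        show "AE x in M. band (D n) (C ?f) x = inverse ?c * band (D n) (C f) x"
          using C.scale[OF f, of "inverse ?c"] by eventually_elim (simp add: band_def)
      qed (use iC in auto)
      moreover have "\<dots> = inverse ?c * L1_nrm M (band (D n) (C f))"
        using c by (simp add: abs_mult)
      ultimately have "inverse ?c * L1_nrm M (band (D n) (C f)) \<le> e" by linarith
      from mult_left_mono[OF this L1_nrm_nonneg[of M f]] c show ?thesis
        by (simp add: mult.assoc[symmetric] mult.commute[of e])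
    qed
  qed
qed

section \<open>Image measures and their densities\<close>

text \<open>If \<open>\<phi>\<close> maps the measure \<open>w \<mu>\<close> to the measure \<open>\<nu>\<close> on the line, then \<open>lift g = w (g \<circ> \<phi>)\<close> embeds
\<open>L\<^sup>1(\<nu>)\<close> isometrically into \<open>L\<^sup>1(\<mu>)\<close>, and taking the density of the image of \<open>f \<mu>\<close> with respect to \<open>\<nu>\<close> is a
positive contraction \<open>push\<close> in the other direction, a left inverse of \<open>lift\<close>.\<close>

locale weighted_pushforward =
  fixes M :: "'a measure" and w \<phi> :: "'a \<Rightarrow> real" and \<nu> :: "real measure"
  assumes w_meas[measurable]: "w \<in> borel_measurable M" and w_nonneg: "\<And>x. 0 \<le> w x"
    and \<phi>_meas[measurable]: "\<phi> \<in> borel_measurable M"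
    and \<nu>_eq: "distr (density M (\<lambda>x. ennreal (w x))) borel \<phi> = \<nu>"
    and finite_\<nu>: "finite_measure \<nu>"
begin

lemma sets_\<nu>[measurable_cong, simp]: "sets \<nu> = sets borel"
  and space_\<nu>[simp]: "space \<nu> = UNIV"
  unfolding \<nu>_eq[symmetric] by simp_all

definition lift :: "(real \<Rightarrow> real) \<Rightarrow> 'a \<Rightarrow> real" where
  "lift g x = w x * g (\<phi> x)"

lemma integrable_lift_iff:
  assumes [measurable]: "g \<in> borel_measurable borel"
  shows "integrable M (lift g) \<longleftrightarrow> integrable \<nu> g"
proof -
  have "integrable \<nu> g \<longleftrightarrow> integrable (density M (\<lambda>x. ennreal (w x))) (\<lambda>x. g (\<phi> x))"
    unfolding \<nu>_eq[symmetric] by (rule integrable_distr_eq) auto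
  also have "\<dots> \<longleftrightarrow> integrable M (\<lambda>x. w x *\<^sub>R g (\<phi> x))"
    by (rule integrable_density) (auto simp: w_nonneg)
  finally show ?thesis by (simp add: lift_def[abs_def])
qed

lemma integral_lift:
  assumes [measurable]: "g \<in> borel_measurable borel"
  shows "(\<integral>x. lift g x \<partial>M) = (\<integral>y. g y \<partial>\<nu>)"
proof -
  have "(\<integral>y. g y \<partial>\<nu>) = (\<integral>x. g (\<phi> x) \<partial>density M (\<lambda>x. ennreal (w x)))"
    unfolding \<nu>_eq[symmetric] by (rule integral_distr) auto
  also have "\<dots> = (\<integral>x. w x *\<^sub>R g (\<phi> x) \<partial>M)"
    by (rule integral_density) (auto simp: w_nonneg)
  finally show ?thesis by (simp add: lift_def[abs_def])
qed

lemma AE_\<nu>_iff: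
  assumes [measurable]: "Measurable.pred borel Q"
  shows "(AE y in \<nu>. Q y) \<longleftrightarrow> (AE x in M. 0 < w x \<longrightarrow> Q (\<phi> x))"
proof -
  have "(AE y in \<nu>. Q y) \<longleftrightarrow> (AE x in density M (\<lambda>x. ennreal (w x)). Q (\<phi> x))"
    unfolding \<nu>_eq[symmetric] by (rule AE_distr_iff) auto
  also have "\<dots> \<longleftrightarrow> (AE x in M. 0 < ennreal (w x) \<longrightarrow> Q (\<phi> x))"
    by (rule AE_density) auto
  finally show ?thesis by simp
qed

lemma positive_lift: "positive_L1_map \<nu> M 1 lift"
proof (rule positive_L1_mapI)
  fix g :: "real \<Rightarrow> real" assume g: "integrable \<nu> g"
  then have [measurable]: "g \<in> borel_measurable borel" 
    using borel_measurable_integrable[OF g] by (simp add: measurable_cong_sets[OF sets_\<nu> refl])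
  show "integrable M (lift g)" using g by (simp add: integrable_lift_iff)
  show "AE x in M. 0 \<le> lift g x" if "AE y in \<nu>. 0 \<le> g y"
  proof -
    have "Measurable.pred borel (\<lambda>y. 0 \<le> g y)" by measurable
    with that have "AE x in M. 0 < w x \<longrightarrow> 0 \<le> g (\<phi> x)" by (simp only: AE_\<nu>_iff)
    then show ?thesis
    proof eventually_elim
      case (elim x)
      then show ?case using w_nonneg[of x] by (cases "w x = 0") (auto simp: lift_def)
    qed
  qed
  show "(\<integral>x. lift g x \<partial>M) \<le> 1 * (\<integral>y. g y \<partial>\<nu>)" by (simp add: integral_lift)
  show "AE x in M. lift (\<lambda>y. c * g y) x = c * lift g x" for c
    by (rule AE_I2) (simp add: lift_def)
  show "AE x in M. lift (\<lambda>y. g y + g' y) x = lift g x + lift g' x" for g'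
    by (rule AE_I2) (simp add: lift_def distrib_left)
qed

text \<open>The image of \<open>f \<mu>\<close> under \<open>\<phi>\<close> is absolutely continuous with respect to \<open>\<nu>\<close> once \<open>f\<close> has been cut
down to the set where \<open>w\<close> is positive.\<close>

definition supp :: "('a \<Rightarrow> real) \<Rightarrow> 'a \<Rightarrow> real" where
  "supp f x = (if 0 < w x then f x else 0)"

lemma integrable_supp: "integrable M f \<Longrightarrow> integrable M (supp f)"
proof -
  assume f: "integrable M f"
  have "{x \<in> space M. 0 < w x} \<in> sets M" by measurable
  from integrable_mult_indicator[OF this f] show ?thesis
    by (rule Bochner_Integration.integrable_cong[THEN iffD1, rotated -1])
       (auto simp: supp_def indicator_def)
qed

text \<open>Linearity and positivity of densities are obtained from uniqueness, so the density is first
characterised by its integrals over Borel sets.\<close>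

definition is_push :: "('a \<Rightarrow> real) \<Rightarrow> (real \<Rightarrow> real) \<Rightarrow> bool" where
  "is_push f g \<longleftrightarrow> integrable \<nu> g \<and>
     (\<forall>B\<in>sets borel. (\<integral>y. indicator B y * g y \<partial>\<nu>) = (\<integral>x. indicator B (\<phi> x) * supp f x \<partial>M))"

lemma integrable_indicator_supp: "integrable M f \<Longrightarrow> B \<in> sets borel \<Longrightarrow> integrable M (\<lambda>x. indicator B (\<phi> x) * supp f x)"
proof -
  assume f: "integrable M f" and B[measurable]: "B \<in> sets borel"
  have "{x \<in> space M. \<phi> x \<in> B} \<in> sets M" by measurable
  from integrable_mult_indicator[OF this integrable_supp[OF f]] show ?thesis
    by (rule Bochner_Integration.integrable_cong[THEN iffD1, rotated -1])
       (auto simp: indicator_def)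
qed

lemma integrable_indicator_\<nu>:
  fixes g :: "real \<Rightarrow> real"
  shows "integrable \<nu> g \<Longrightarrow> B \<in> sets borel \<Longrightarrow> integrable \<nu> (\<lambda>y. indicator B y * g y)"
  using integrable_mult_indicator[of B \<nu> g] by simp

lemma is_push_unique:
  assumes "is_push f g" "is_push f g'"
  shows "AE y in \<nu>. g y = g' y"
proof (rule density_unique_real)
  show "integrable \<nu> g" "integrable \<nu> g'" using assms by (simp_all only: is_push_def)
  fix B assume "B \<in> sets \<nu>"
  then have "B \<in> sets borel" by simp
  with assms show "(\<integral>y\<in>B. g y \<partial>\<nu>) = (\<integral>y\<in>B. g' y \<partial>\<nu>)"
    unfolding is_push_def set_lebesgue_integral_def real_scaleR_def by metis
qed

lemma is_push_lincomb:
  assumes "is_push f g" "is_push f' g'" "integrable M f" "integrable M f'"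
  shows "is_push (\<lambda>x. a * f x + b * f' x) (\<lambda>y. a * g y + b * g' y)"
  unfolding is_push_def
proof (intro conjI ballI)
  have g: "integrable \<nu> g" "integrable \<nu> g'" using assms by (auto simp: is_push_def)
  then show "integrable \<nu> (\<lambda>y. a * g y + b * g' y)" by auto
  fix B :: "real set" assume B: "B \<in> sets borel"
  have "(\<integral>y. indicator B y * (a * g y + b * g' y) \<partial>\<nu>)
      = (\<integral>y. a * (indicator B y * g y) + b * (indicator B y * g' y) \<partial>\<nu>)"
    by (simp add: algebra_simps)
  also have "\<dots> = a * (\<integral>y. indicator B y * g y \<partial>\<nu>) + b * (\<integral>y. indicator B y * g' y \<partial>\<nu>)"
    using integrable_indicator_\<nu>[OF _ B] g by simp
  also have "\<dots> = a * (\<integral>x. indicator B (\<phi> x) * supp f x \<partial>M) + b * (\<integral>x. indicator B (\<phi> x) * supp f' x \<partial>M)"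
    using assms B by (simp add: is_push_def)
  also have "\<dots> = (\<integral>x. a * (indicator B (\<phi> x) * supp f x) + b * (indicator B (\<phi> x) * supp f' x) \<partial>M)"
    using integrable_indicator_supp[OF _ B] assms by simp
  also have "\<dots> = (\<integral>x. indicator B (\<phi> x) * supp (\<lambda>x. a * f x + b * f' x) x \<partial>M)"
    by (intro Bochner_Integration.integral_cong) (auto simp: supp_def algebra_simps)
  finally show "(\<integral>y. indicator B y * (a * g y + b * g' y) \<partial>\<nu>) =
    (\<integral>x. indicator B (\<phi> x) * supp (\<lambda>x. a * f x + b * f' x) x \<partial>M)" .
qed

lemma is_push_cong:
  assumes "is_push f g" "integrable M f" "integrable M f'" "AE x in M. f x = f' x"
  shows "is_push f' g"
proof -
  have "(\<integral>x. indicator B (\<phi> x) * supp f x \<partial>M) = (\<integral>x. indicator B (\<phi> x) * supp f' x \<partial>M)"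
    if "B \<in> sets borel" for B
    using assms(4) integrable_indicator_supp[OF assms(2) that] integrable_indicator_supp[OF assms(3) that]
    by (intro integral_cong_AE) (auto elim!: eventually_mono simp: supp_def)
  with assms(1) show ?thesis by (simp add: is_push_def)
qed

lemma is_push_exists_nonneg:
  assumes f: "integrable M f" and f0: "\<And>x. 0 \<le> f x"
  shows "\<exists>g. is_push f g \<and> (\<forall>y. 0 \<le> g y)"
proof -
  interpret \<nu>: finite_measure \<nu> by (rule finite_\<nu>)
  have sf: "integrable M (supp f)" by (rule integrable_supp[OF f])
  have sf0: "0 \<le> supp f x" for x using f0 by (simp add: supp_def)
  have [measurable]: "supp f \<in> borel_measurable M" using sf by simp
  define N where "N = distr (density M (\<lambda>x. ennreal (supp f x))) borel \<phi>"
  have N: "emeasure N B = ennreal (\<integral>x. indicator B (\<phi> x) * supp f x \<partial>M)"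
    if B[measurable]: "B \<in> sets borel" for B
  proof -
    have "emeasure N B = emeasure (density M (\<lambda>x. ennreal (supp f x))) (\<phi> -` B \<inter> space M)"
      unfolding N_def by (subst emeasure_distr) auto
    also have "\<dots> = (\<integral>\<^sup>+x. ennreal (supp f x) * indicator (\<phi> -` B \<inter> space M) x \<partial>M)"
      by (rule emeasure_density) auto
    also have "\<dots> = (\<integral>\<^sup>+x. ennreal (indicator B (\<phi> x) * supp f x) \<partial>M)"
      by (intro nn_integral_cong) (auto simp: indicator_def)
    also have "\<dots> = ennreal (\<integral>x. indicator B (\<phi> x) * supp f x \<partial>M)"
      by (rule nn_integral_eq_integral[OF integrable_indicator_supp[OF f B]]) (simp add: sf0)
    finally show ?thesis .
  qed
  have setsN: "sets N = sets \<nu>" by (simp add: N_def)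
  have finN: "finite_measure N"
    by (rule finite_measureI) (simp add: N N_def[THEN arg_cong[where f=space]])
  have "absolutely_continuous \<nu> N"
    unfolding absolutely_continuous_def
  proof
    fix B assume B: "B \<in> null_sets \<nu>"
    then have [measurable]: "B \<in> sets borel" by auto
    from AE_not_in[OF B] have "AE x in M. 0 < w x \<longrightarrow> \<phi> x \<notin> B"
      by (subst (asm) AE_\<nu>_iff) auto
    then have "AE x in M. indicator B (\<phi> x) * supp f x = 0"
      by eventually_elim (auto simp: supp_def)
    then have "(\<integral>x. indicator B (\<phi> x) * supp f x \<partial>M) = 0"
      by (intro integral_eq_zero_AE)
    then show "B \<in> null_sets N" using N[of B] setsN by (intro null_setsI) auto
  qed
  from \<nu>.Radon_Nikodym_finite_measure[OF finN setsN this]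
  obtain h where h[measurable]: "h \<in> borel_measurable \<nu>" and hN: "density \<nu> h = N" by auto
  have hB: "(\<integral>\<^sup>+y. h y * indicator B y \<partial>\<nu>) = ennreal (\<integral>x. indicator B (\<phi> x) * supp f x \<partial>M)"
    if "B \<in> sets borel" for B
    using emeasure_density[OF h, of B] that by (simp add: hN N)
  have "(\<integral>\<^sup>+y. h y \<partial>\<nu>) \<noteq> \<infinity>" using hB[of UNIV] by simp
  then have fin: "AE y in \<nu>. h y \<noteq> \<infinity>" by (intro nn_integral_PInf_AE) auto
  define g where "g y = enn2real (h y)" for y
  have [measurable]: "g \<in> borel_measurable \<nu>" unfolding g_def[abs_def] by measurable
  have gB: "(\<integral>\<^sup>+y. ennreal (indicator B y * g y) \<partial>\<nu>) = ennreal (\<integral>x. indicator B (\<phi> x) * supp f x \<partial>M)"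
    if "B \<in> sets borel" for B
  proof -
    have "(\<integral>\<^sup>+y. ennreal (indicator B y * g y) \<partial>\<nu>) = (\<integral>\<^sup>+y. h y * indicator B y \<partial>\<nu>)"
      using fin by (intro nn_integral_cong_AE) 
        (auto elim!: eventually_mono simp: g_def indicator_def less_top)
    then show ?thesis using hB[OF that] by simp
  qed
  have "is_push f g"
    unfolding is_push_def
  proof (intro conjI ballI)
    show "integrable \<nu> g"
      using gB[of UNIV] by (intro integrableI_nonneg) (auto simp: g_def)
    fix B :: "real set" assume [measurable]: "B \<in> sets borel"
    have "(\<integral>y. indicator B y * g y \<partial>\<nu>) = enn2real (\<integral>\<^sup>+y. ennreal (indicator B y * g y) \<partial>\<nu>)"
      by (rule integral_eq_nn_integral) (auto simp: g_def)
    also have "\<dots> = (\<integral>x. indicator B (\<phi> x) * supp f x \<partial>M)"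
      using gB[of B] sf0 by (simp add: Bochner_Integration.integral_nonneg)
    finally show "(\<integral>y. indicator B y * g y \<partial>\<nu>) = (\<integral>x. indicator B (\<phi> x) * supp f x \<partial>M)" .
  qed
  then show ?thesis by (auto simp: g_def)
qed

lemma is_push_exists:
  assumes f: "integrable M f"
  shows "\<exists>g. is_push f g"
proof -
  obtain g1 g2 where "is_push (\<lambda>x. max 0 (f x)) g1" "is_push (\<lambda>x. max 0 (- f x)) g2"
    using is_push_exists_nonneg[of "\<lambda>x. max 0 (f x)"] is_push_exists_nonneg[of "\<lambda>x. max 0 (- f x)"] f
    by auto
  then have "is_push (\<lambda>x. 1 * max 0 (f x) + (-1) * max 0 (- f x)) (\<lambda>y. 1 * g1 y + (-1) * g2 y)"
    using f by (intro is_push_lincomb) auto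
  moreover have "(\<lambda>x. 1 * max 0 (f x) + (-1) * max 0 (- f x)) = f" by (auto simp: max_def)
  ultimately show ?thesis by auto
qed

definition push :: "('a \<Rightarrow> real) \<Rightarrow> real \<Rightarrow> real" where
  "push f = (SOME g. is_push f g)"

lemma is_push_push: "integrable M f \<Longrightarrow> is_push f (push f)"
  unfolding push_def by (rule someI_ex[OF is_push_exists])

lemma positive_push: "positive_L1_map M \<nu> 1 push"
proof (rule positive_L1_mapI)
  fix f f' :: "'a \<Rightarrow> real" and c assume f: "integrable M f"
  note pf = is_push_push[OF f]
  show "integrable \<nu> (push f)" using pf by (simp add: is_push_def)
  show "AE y in \<nu>. push (\<lambda>x. c * f x) y = c * push f y"
  proof (rule is_push_unique)
    show "is_push (\<lambda>x. c * f x) (push (\<lambda>x. c * f x))"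
      using f by (intro is_push_push) auto
    show "is_push (\<lambda>x. c * f x) (\<lambda>y. c * push f y)"
      using is_push_lincomb[OF pf pf f f, of c 0] by simp
  qed
  show "AE y in \<nu>. 0 \<le> push f y" if ae: "AE x in M. 0 \<le> f x"
  proof -
    obtain g where g: "is_push (\<lambda>x. max 0 (f x)) g" "\<And>y. 0 \<le> g y"
      using is_push_exists_nonneg[of "\<lambda>x. max 0 (f x)"] f by auto
    have "is_push f g"
      using f ae by (intro is_push_cong[OF g(1)]) (auto elim: eventually_mono)
    from is_push_unique[OF pf this] show ?thesis by eventually_elim (simp add: g)
  qed
  show "(\<integral>y. push f y \<partial>\<nu>) \<le> 1 * (\<integral>x. f x \<partial>M)" if f0: "\<And>x. 0 \<le> f x"
  proof -
    have "(\<integral>y. push f y \<partial>\<nu>) = (\<integral>x. supp f x \<partial>M)"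
      using conjunct2[OF pf[unfolded is_push_def], rule_format, of UNIV] by simp
    also have "\<dots> \<le> (\<integral>x. f x \<partial>M)"
      using f0 by (intro integral_mono integrable_supp f) (simp add: supp_def)
    finally show ?thesis by simp
  qed
  assume f': "integrable M f'"
  show "AE y in \<nu>. push (\<lambda>x. f x + f' x) y = push f y + push f' y"
  proof (rule is_push_unique)
    show "is_push (\<lambda>x. f x + f' x) (push (\<lambda>x. f x + f' x))"
      using f f' by (intro is_push_push) auto
    show "is_push (\<lambda>x. f x + f' x) (\<lambda>y. push f y + push f' y)"
      using is_push_lincomb[OF pf is_push_push[OF f'] f f', of 1 1] by simp
  qed
qed

lemma push_lift:
  assumes g: "integrable \<nu> g"
  shows "AE y in \<nu>. push (lift g) y = g y"
proof (rule is_push_unique[OF is_push_push])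
  have [measurable]: "g \<in> borel_measurable borel" 
    using borel_measurable_integrable[OF g] by (simp add: measurable_cong_sets[OF sets_\<nu> refl])
  show "integrable M (lift g)" using g by (simp add: integrable_lift_iff)
  show "is_push (lift g) g"
    unfolding is_push_def
  proof (intro conjI ballI g)
    fix B :: "real set" assume [measurable]: "B \<in> sets borel"
    have "supp (lift g) x = lift g x" for x
      using w_nonneg[of x] by (auto simp: supp_def lift_def)
    then have "(\<integral>x. indicator B (\<phi> x) * supp (lift g) x \<partial>M) = (\<integral>x. lift (\<lambda>y. indicator B y * g y) x \<partial>M)"
      by (simp add: lift_def mult_ac)
    then show "(\<integral>y. indicator B y * g y \<partial>\<nu>) = (\<integral>x. indicator B (\<phi> x) * supp (lift g) x \<partial>M)"
      by (simp add: integral_lift)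
  qed
qed

lemma band_lift:
  assumes "\<And>x. x \<in> space M \<Longrightarrow> x \<notin> D \<Longrightarrow> w x = 0" "x \<in> space M"
  shows "band D (lift g) x = lift g x"
  using assms by (auto simp: band_def lift_def indicator_def)

end

section \<open>Spreading a probability measure on the line\<close>

lemma countable_in_borel: "countable S \<Longrightarrow> S \<in> sets (borel :: real measure)"
  by (rule sets.countable) auto

text \<open>Without atoms the distribution function is continuous, so it has no jump at a quantile.\<close>

lemma atomless_cdf_quantile:
  assumes "real_distribution \<kappa>" and atomless: "\<And>x. measure \<kappa> {x} = 0"
    and \<omega>: "0 < \<omega>" "\<omega> < 1"
  shows "cdf \<kappa> (Inf {x. \<omega> \<le> cdf \<kappa> x}) = \<omega>"
proof -
  interpret cdf_distribution \<kappa>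
    unfolding cdf_distribution_def by fact
  have ge: "\<omega> \<le> C (I \<omega>)" using pseudoinverse[OF \<omega>] by blast
  have "isCont C (I \<omega>)" using atomless by (simp add: isCont_cdf)
  then have "(C \<longlongrightarrow> C (I \<omega>)) (at_left (I \<omega>))"
    unfolding isCont_def by (rule filterlim_mono) (auto simp: at_le)
  moreover have "C x < \<omega>" if "x < I \<omega>" for x
    using pseudoinverse[OF \<omega>, of x] that by auto
  then have "eventually (\<lambda>x. C x \<le> \<omega>) (at_left (I \<omega>))"
    by (intro eventually_at_leftI[of "I \<omega> - 1"]) (auto intro: less_imp_le)
  ultimately have "C (I \<omega>) \<le> \<omega>"
    by (intro tendsto_upperbound) auto
  with ge show ?thesis by simp
qed

text \<open>The distribution function of \<open>\<kappa>\<close> turns \<open>\<kappa>\<close> into the uniform distribution on the unit interval, and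
the quantile function of \<open>\<nu>\<close> turns the latter into \<open>\<nu>\<close>.\<close>

lemma atomless_pushes_to_any:
  assumes \<kappa>: "real_distribution \<kappa>" and atomless: "\<And>x. measure \<kappa> {x} = 0"
    and \<nu>: "real_distribution \<nu>"
  shows "\<exists>\<psi>. \<psi> \<in> borel_measurable borel \<and> distr \<kappa> borel \<psi> = \<nu>"
proof -
  interpret K: cdf_distribution \<kappa> unfolding cdf_distribution_def by fact
  interpret N: cdf_distribution \<nu> unfolding cdf_distribution_def by fact
  let ?\<Omega> = "restrict_space lborel {0<..<1::real}"
  \<comment> \<open>The quantile function is meaningful on the open unit interval only.\<close>
  define q where "q \<omega> = indicator {0<..<1} \<omega> *\<^sub>R N.I \<omega>" for \<omega> :: real
  have [measurable]: "q \<in> borel_measurable borel"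
    unfolding q_def[abs_def]
    by (subst borel_measurable_restrict_space_iff[symmetric]) (auto intro: N.measurable_CI)
  have sets_K[measurable_cong]: "sets \<kappa> = sets borel" by simp
  have I_meas: "K.I \<in> ?\<Omega> \<rightarrow>\<^sub>M borel"
    using K.measurable_CI by (simp add: measurable_cong_sets[OF sets_restrict_space_cong[OF sets_lborel] refl])
  have "distr \<kappa> borel (\<lambda>x. q (cdf \<kappa> x)) = distr (distr ?\<Omega> borel K.I) borel (\<lambda>x. q (cdf \<kappa> x))"
    by (simp only: K.distr_I_eq_M)
  also have "\<dots> = distr ?\<Omega> borel ((\<lambda>x. q (cdf \<kappa> x)) \<circ> K.I)"
    by (rule distr_distr) (use I_meas in measurable)
  also have "\<dots> = distr ?\<Omega> borel N.I"
    by (rule distr_cong)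
       (auto simp: space_restrict_space q_def atomless_cdf_quantile[OF \<kappa> atomless])
  also have "\<dots> = \<nu>" by (rule N.distr_I_eq_M)
  finally show ?thesis
    by (intro exI[of _ "\<lambda>x. q (cdf \<kappa> x)"]) auto
qed

text \<open>Preimages under the distribution function of disjoint subintervals of the unit interval.\<close>

lemma atomless_disjoint_sets:
  assumes \<kappa>: "real_distribution \<kappa>" and atomless: "\<And>x. measure \<kappa> {x} = 0"
  shows "\<exists>D :: nat \<Rightarrow> real set. (\<forall>n. D n \<in> sets borel \<and> 0 < emeasure \<kappa> (D n)) \<and> disjoint_family D"
proof -
  interpret K: cdf_distribution \<kappa> unfolding cdf_distribution_def by fact
  let ?\<Omega> = "restrict_space lborel {0<..<1::real}"
  define J where "J n = {1 / real (n + 2)<..1 / real (n + 1)}" for n :: nat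
  define D where "D n = cdf \<kappa> -` J n" for n
  have D[measurable]: "D n \<in> sets borel" for n
    unfolding D_def J_def using measurable_sets_borel[OF K.measurable_C] by auto
  have disj: "disjoint_family J"
    unfolding disjoint_family_on_def
  proof (intro ballI impI)
    fix m n :: nat assume "m \<noteq> n"
    moreover have "J m \<inter> J n = {}" if "m < n" for m n
    proof -
      have "1 / real (n + 1) \<le> 1 / real (m + 2)" using that by (intro divide_left_mono) auto
      then show ?thesis by (auto simp: J_def)
    qed
    ultimately show "J m \<inter> J n = {}" by (metis Int_commute nat_neq_iff)
  qed
  have I_meas: "K.I \<in> ?\<Omega> \<rightarrow>\<^sub>M borel"
    using K.measurable_CI by (simp add: measurable_cong_sets[OF sets_restrict_space_cong[OF sets_lborel] refl])
  have pos: "0 < emeasure \<kappa> (D n)" for n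
  proof -
    let ?G = "{1 / real (n + 2)<..<1 / real (n + 1)}"
    have G: "?G \<subseteq> {0<..<1}"
    proof
      fix \<omega> assume w: "\<omega> \<in> ?G"
      have "0 < 1 / real (n + 2)" "1 / real (n + 1) \<le> 1" by auto
      with w show "\<omega> \<in> {0<..<1}" unfolding greaterThanLessThan_iff by linarith
    qed
    have "1 / real (n + 2) < 1 / real (n + 1)" by (rule divide_strict_left_mono) auto
    then have "0 < emeasure lborel ?G" by simp
    also have "emeasure lborel ?G = emeasure ?\<Omega> ?G"
      using G by (subst emeasure_restrict_space) auto
    also have "\<dots> \<le> emeasure ?\<Omega> (K.I -` D n \<inter> space ?\<Omega>)"
    proof (rule emeasure_mono)
      show "?G \<subseteq> K.I -` D n \<inter> space ?\<Omega>"
      proof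
        fix \<omega> assume w: "\<omega> \<in> ?G"
        with G have w01: "0 < \<omega>" "\<omega> < 1" by auto
        from atomless_cdf_quantile[OF \<kappa> atomless w01] w w01
        show "\<omega> \<in> K.I -` D n \<inter> space ?\<Omega>" by (simp add: D_def J_def space_restrict_space)
      qed
      show "K.I -` D n \<inter> space ?\<Omega> \<in> sets ?\<Omega>" by (rule measurable_sets[OF I_meas D])
    qed
    also have "\<dots> = emeasure (distr ?\<Omega> borel K.I) (D n)"
      by (rule emeasure_distr[symmetric, OF I_meas]) simp
    finally show ?thesis by (simp only: K.distr_I_eq_M)
  qed
  have "disjoint_family D" using disj by (fastforce simp: disjoint_family_on_def D_def)
  with pos D show ?thesis by blast
qed

lemma uniform_measure_real_distribution:
  assumes "real_distribution \<nu>" and B: "B \<in> sets borel" "0 < emeasure \<nu> B" 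
  shows "real_distribution (uniform_measure \<nu> B)"
    and "uniform_measure \<nu> B = density \<nu> (\<lambda>x. ennreal (indicator B x / measure \<nu> B))"
proof -
  interpret real_distribution \<nu> by fact
  have "prob_space (uniform_measure \<nu> B)"
    using B emeasure_finite[of B] by (intro prob_space_uniform_measure) auto
  then show "real_distribution (uniform_measure \<nu> B)"
    by (simp add: real_distribution_def real_distribution_axioms_def)
  have "0 < measure \<nu> B" using B(2) by (simp add: emeasure_eq_measure)
  then show "uniform_measure \<nu> B = density \<nu> (\<lambda>x. ennreal (indicator B x / measure \<nu> B))"
    unfolding uniform_measure_def
    by (intro arg_cong[where f="density \<nu>"] ext)
       (simp add: emeasure_eq_measure divide_ennreal[symmetric] indicator_def)
qed

text \<open>There are infinitely many disjoint sets, each of which carries enough mass of \<open>\<nu>\<close> to be mapped, after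
reweighting, onto all of \<open>\<nu>\<close>.\<close>

definition spreadable :: "real measure \<Rightarrow> bool" where
  "spreadable \<nu> \<longleftrightarrow> (\<exists>D v \<psi>. disjoint_family (D :: nat \<Rightarrow> real set) \<and>
     (\<forall>n. D n \<in> sets borel \<and> v n \<in> borel_measurable borel \<and> \<psi> n \<in> borel_measurable borel \<and>
        (\<forall>y. 0 \<le> v n y) \<and> (\<forall>y. y \<notin> D n \<longrightarrow> v n y = 0) \<and>
        distr (density \<nu> (\<lambda>y. ennreal (v n y :: real))) borel (\<psi> n) = \<nu>))"

text \<open>Any nonnull part of the diffuse component can be mapped onto \<open>\<nu>\<close>, whatever atoms \<open>\<nu>\<close> has.\<close>

lemma spreadable_diffuse:
  assumes \<nu>: "real_distribution \<nu>"
    and pos: "0 < emeasure \<nu> (- {x. 0 < measure \<nu> {x}})"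
  shows "spreadable \<nu>"
proof -
  interpret real_distribution \<nu> by fact
  define S where "S = {x. 0 < measure \<nu> {x}}"
  have "countable S" unfolding S_def by (rule countable_atoms)
  then have S[measurable]: "S \<in> sets borel" by (rule countable_in_borel)
  have atomless: "measure (uniform_measure \<nu> B) {x} = 0"
    if B: "B \<in> sets borel" "0 < emeasure \<nu> B" "B \<inter> S = {}" for B x
  proof -
    have "measure \<nu> (B \<inter> {x}) = 0"
    proof (cases "x \<in> B")
      case True
      then have "x \<notin> S" using B by auto
      then have "measure \<nu> {x} = 0" using measure_nonneg[of \<nu> "{x}"] by (simp add: S_def)
      then show ?thesis using True by simp
    qed simp
    moreover have "measure (uniform_measure \<nu> B) {x} = measure \<nu> (B \<inter> {x}) / measure \<nu> B"
      using B(2) emeasure_finite[of B] by (intro measure_uniform_measure) auto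
    ultimately show ?thesis by simp
  qed
  have S': "- S \<in> sets borel" "0 < emeasure \<nu> (- S)" "- S \<inter> S = {}"
    using pos S by (auto simp: S_def)
  obtain D' :: "nat \<Rightarrow> real set" where D': "\<And>n. D' n \<in> sets borel"
    "\<And>n. 0 < emeasure (uniform_measure \<nu> (- S)) (D' n)" "disjoint_family D'"
    using atomless_disjoint_sets[OF uniform_measure_real_distribution(1)[OF \<nu> S'(1,2)]
      atomless[OF S']] by blast
  define D where "D n = - S \<inter> D' n" for n
  have D: "D n \<in> sets borel" "0 < emeasure \<nu> (D n)" "D n \<inter> S = {}" for n
  proof -
    show "D n \<in> sets borel" using D'(1) S by (auto simp: D_def)
    have "emeasure (uniform_measure \<nu> (- S)) (D' n) = emeasure \<nu> (D n) / emeasure \<nu> (- S)"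
      using D'(1) S'(1) unfolding D_def by (intro emeasure_uniform_measure) auto
    with D'(2)[of n] show "0 < emeasure \<nu> (D n)" by (cases "emeasure \<nu> (D n) = 0") (auto simp: zero_less_iff_neq_zero)
  qed (auto simp: D_def)
  have "\<forall>n. \<exists>\<psi>. \<psi> \<in> borel_measurable borel \<and> distr (uniform_measure \<nu> (D n)) borel \<psi> = \<nu>"
    by (intro allI atomless_pushes_to_any uniform_measure_real_distribution(1) \<nu> D atomless)
  then obtain \<psi> where \<psi>: "\<And>n. \<psi> n \<in> borel_measurable borel"
    "\<And>n. distr (uniform_measure \<nu> (D n)) borel (\<psi> n) = \<nu>" by metis
  show ?thesis
    unfolding spreadable_def
  proof (rule exI[of _ D], rule exI[of _ "\<lambda>n y. indicator (D n) y / measure \<nu> (D n)"],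
      rule exI[of _ \<psi>], intro conjI allI impI)
    show "disjoint_family D" using D'(3) by (auto simp: disjoint_family_on_def D_def)
    fix n
    show "distr (density \<nu> (\<lambda>y. ennreal (indicator (D n) y / measure \<nu> (D n)))) borel (\<psi> n) = \<nu>"
      using \<psi>(2)[of n] by (simp add: uniform_measure_real_distribution(2)[OF \<nu> D(1,2)])
    show "(\<lambda>y. indicator (D n) y / measure \<nu> (D n)) \<in> borel_measurable borel"
      using D(1)[of n] by measurable
  qed (use D \<psi> in auto)
qed

lemma measure_eq_on_countable_support:
  fixes N1 N2 :: "real measure"
  assumes sets: "sets N1 = sets borel" "sets N2 = sets borel"
    and S: "countable S" and ae: "AE y in N1. y \<in> S" "AE y in N2. y \<in> S"
    and eq: "\<And>y. y \<in> S \<Longrightarrow> emeasure N1 {y} = emeasure N2 {y}"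
  shows "N1 = N2"
proof (rule measure_eqI)
  show "sets N1 = sets N2" using sets by simp
  fix B assume "B \<in> sets N1"
  then have B: "B \<in> sets borel" using sets by simp
  have SB: "S \<inter> B \<in> sets borel" using countable_in_borel[OF S] B by auto
  have "emeasure N1 B = emeasure N1 (S \<inter> B)"
    using ae(1) B SB sets by (intro emeasure_eq_AE) auto
  also have "\<dots> = (\<integral>\<^sup>+y. emeasure N1 {y} \<partial>count_space (S \<inter> B))"
    using S sets by (intro emeasure_countable_singleton) auto
  also have "\<dots> = (\<integral>\<^sup>+y. emeasure N2 {y} \<partial>count_space (S \<inter> B))"
    by (intro nn_integral_cong) (simp add: eq)
  also have "\<dots> = emeasure N2 (S \<inter> B)"
    using S sets by (intro emeasure_countable_singleton[symmetric]) auto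
  also have "\<dots> = emeasure N2 B"
    using ae(2) B SB sets by (intro emeasure_eq_AE) auto
  finally show "emeasure N1 B = emeasure N2 B" .
qed

text \<open>Infinitely many atoms are split into infinitely many infinite families by a pairing function on
their indices. In family \<open>n\<close> the atom with index \<open>(n, i)\<close> is sent to the \<open>i\<close>-th atom, with a weight that corrects its mass.\<close>

lemma spreadable_atomic:
  assumes \<nu>: "real_distribution \<nu>"
    and ae: "AE y in \<nu>. 0 < measure \<nu> {y}" and inf: "infinite {y. 0 < measure \<nu> {y}}"
  shows "spreadable \<nu>"
proof -
  interpret real_distribution \<nu> by fact
  define S where "S = {x. 0 < measure \<nu> {x}}"
  have S: "countable S" unfolding S_def by (rule countable_atoms)
  have infS: "infinite S" using inf by (simp add: S_def)
  define s where "s = from_nat_into S"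
  define t where "t = to_nat_on S"
  have st: "s (t y) = y" if "y \<in> S" for y using S that by (simp add: s_def t_def)
  have ts: "t (s i) = i" for i using S infS by (simp add: s_def t_def)
  have sS: "s i \<in> S" for i using infS by (simp add: s_def from_nat_into infinite_imp_nonempty)
  define a where "a y = s (snd (prod_decode (t y)))" for y
  define D where "D n = {y\<in>S. fst (prod_decode (t y)) = n}" for n
  define \<psi> where "\<psi> n y = (if y \<in> D n then a y else 0)" for n y
  define v where "v n y = (if y \<in> D n then measure \<nu> {a y} / measure \<nu> {y} else 0)" for n y
  have DS: "D n \<subseteq> S" for n by (auto simp: D_def)
  then have cD: "countable (D n)" for n using S by (rule countable_subset)
  have [measurable]: "\<psi> n \<in> borel_measurable borel" for n
    by (rule measurable_discrete_difference[of "\<lambda>_. 0", OF _ cD[of n]]) (auto simp: \<psi>_def)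
  have [measurable]: "v n \<in> borel_measurable borel" for n
    by (rule measurable_discrete_difference[of "\<lambda>_. 0", OF _ cD[of n]]) (auto simp: v_def)
  have eq: "distr (density \<nu> (\<lambda>y. ennreal (v n y))) borel (\<psi> n) = \<nu>" for n
  proof (rule measure_eq_on_countable_support[OF _ _ S])
    show "AE y in \<nu>. y \<in> S" using ae by (simp add: S_def)
    have "AE x in \<nu>. 0 < ennreal (v n x) \<longrightarrow> \<psi> n x \<in> S"
      by (rule AE_I2) (auto simp: v_def \<psi>_def a_def sS split: if_splits)
    then have "AE x in density \<nu> (\<lambda>y. ennreal (v n y)). \<psi> n x \<in> S"
      by (subst AE_density) auto
    moreover have "{y. y \<in> S} \<in> sets borel" using countable_in_borel[OF S] by simp
    ultimately show "AE y in distr (density \<nu> (\<lambda>y. ennreal (v n y))) borel (\<psi> n). y \<in> S"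
      by (subst AE_distr_iff) auto
    fix y assume y: "y \<in> S"
    define x where "x = s (prod_encode (n, t y))"
    have x: "x \<in> D n" "a x = y" using y by (simp_all add: x_def D_def a_def sS ts st)
    have uniq: "z = x" if "z \<in> D n" "a z = y" for z
    proof -
      have "snd (prod_decode (t z)) = t y" using that(2) by (auto simp: a_def ts)
      moreover have "fst (prod_decode (t z)) = n" using that(1) by (simp add: D_def)
      ultimately have "prod_decode (t z) = (n, t y)" by (simp add: prod_eq_iff)
      then have "t z = prod_encode (n, t y)" by (metis prod_decode_inverse)
      then have "s (t z) = x" by (simp add: x_def)
      moreover have "z \<in> S" using that(1) by (simp add: D_def)
      ultimately show ?thesis by (simp add: st)
    qed
    have "emeasure (distr (density \<nu> (\<lambda>y. ennreal (v n y))) borel (\<psi> n)) {y}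
        = emeasure (density \<nu> (\<lambda>y. ennreal (v n y))) (\<psi> n -` {y})"
      by (subst emeasure_distr) auto
    also have "\<dots> = (\<integral>\<^sup>+z. ennreal (v n z) * indicator (\<psi> n -` {y}) z \<partial>\<nu>)"
      by (rule emeasure_density) (use measurable_sets_borel[of "\<psi> n" borel "{y}"] in auto)
    also have "\<dots> = (\<integral>\<^sup>+z. ennreal (v n x) * indicator {x} z \<partial>\<nu>)"
    proof (rule nn_integral_cong)
      fix z
      show "ennreal (v n z) * indicator (\<psi> n -` {y}) z = ennreal (v n x) * indicator {x} z"
      proof (cases "z = x")
        case True
        then show ?thesis using x by (simp add: \<psi>_def)
      next
        case False
        then have "z \<notin> D n \<or> a z \<noteq> y" using uniq by blast
        then show ?thesis using False by (auto simp: v_def \<psi>_def)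
      qed
    qed
    also have "\<dots> = ennreal (v n x) * emeasure \<nu> {x}"
      by (rule nn_integral_cmult_indicator) auto
    also have "\<dots> = ennreal (v n x * measure \<nu> {x})"
      by (simp add: emeasure_eq_measure ennreal_mult' v_def)
    also have "v n x * measure \<nu> {x} = measure \<nu> {y}"
      using x DS[of n] by (auto simp: v_def S_def)
    finally show "emeasure (distr (density \<nu> (\<lambda>y. ennreal (v n y))) borel (\<psi> n)) {y} = emeasure \<nu> {y}"
      by (simp add: emeasure_eq_measure)
  qed auto
  show ?thesis
    unfolding spreadable_def
  proof (rule exI[of _ D], rule exI[of _ v], rule exI[of _ \<psi>], intro conjI allI impI)
    show "disjoint_family D" by (auto simp: disjoint_family_on_def D_def)
    fix n
    show "distr (density \<nu> (\<lambda>y. ennreal (v n y))) borel (\<psi> n) = \<nu>" by (rule eq)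
    show "D n \<in> sets borel" by (rule countable_in_borel[OF cD])
  qed (auto simp: v_def)
qed

lemma spreadable_of_infinite_support:
  assumes \<nu>: "real_distribution \<nu>" and inf: "\<And>S. finite S \<Longrightarrow> \<not> (AE y in \<nu>. y \<in> S)"
  shows "spreadable \<nu>"
proof -
  interpret real_distribution \<nu> by fact
  define S where "S = {x. 0 < measure \<nu> {x}}"
  have "countable S" unfolding S_def by (rule countable_atoms)
  then have S: "S \<in> sets borel" by (rule countable_in_borel)
  show ?thesis
  proof (cases "emeasure \<nu> (- S) = 0")
    case True
    then have "- S \<in> null_sets \<nu>" using S by auto
    then have ae: "AE y in \<nu>. y \<in> S" by (rule AE_I'[of "- S"]) auto
    with inf have "infinite S" by blast
    with ae show ?thesis using \<nu> by (intro spreadable_atomic) (auto simp: S_def)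
  next
    case False
    then show ?thesis using \<nu> by (intro spreadable_diffuse) (auto simp: S_def zero_less_iff_neq_zero)
  qed
qed

section \<open>Separable spaces as spaces over the line\<close>

text \<open>Ternary expansions with digits \<open>0\<close> and \<open>1\<close> encode a sequence of truth values in a real number. Base
\<open>3\<close> rather than \<open>2\<close> leaves a gap between the two cases of the leading digit, so that decoding is unambiguous.\<close>

definition ternary_shift :: "real \<Rightarrow> real" where
  "ternary_shift t = 3 * (t - of_bool (1 \<le> t))"

definition ternary_digit :: "nat \<Rightarrow> real \<Rightarrow> bool" where
  "ternary_digit k t \<longleftrightarrow> 1 \<le> (ternary_shift ^^ k) t"

lemma summable_ternary: "summable (\<lambda>i. of_bool (c i) * (1 / 3 :: real) ^ i)"
  by (rule summable_comparison_test'[of "\<lambda>i. (1 / 3) ^ i" 0]) (auto intro: summable_geometric)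

lemma ternary_digit_series: "ternary_digit k (\<Sum>i. of_bool (c i) * (1 / 3) ^ i) \<longleftrightarrow> c k"
proof -
  define S where "S k = (\<Sum>i. of_bool (c (i + k)) * (1 / 3 :: real) ^ i)" for k
  have S_Suc: "S k = of_bool (c k) + S (Suc k) / 3" for k
  proof -
    have "S k = of_bool (c k) + (\<Sum>i. of_bool (c (Suc i + k)) * (1 / 3) ^ Suc i)"
      using suminf_split_head[OF summable_ternary[of "\<lambda>i. c (i + k)"]] by (simp add: S_def)
    also have "(\<Sum>i. of_bool (c (Suc i + k)) * (1 / 3 :: real) ^ Suc i)
        = (\<Sum>i. (1 / 3) * (of_bool (c (i + Suc k)) * (1 / 3) ^ i))"
      by (simp add: mult_ac)
    also have "\<dots> = 1 / 3 * S (Suc k)"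
      unfolding S_def by (rule suminf_mult[OF summable_ternary])
    finally show ?thesis by simp
  qed
  have S0: "0 \<le> S k" for k
    unfolding S_def by (intro suminf_nonneg summable_ternary) simp
  have S_le: "S k \<le> 3 / 2" for k
  proof -
    have "S k \<le> (\<Sum>i. (1 / 3) ^ i)"
      unfolding S_def by (intro suminf_le summable_ternary summable_geometric) auto
    also have "\<dots> = 3 / 2" by (subst suminf_geometric) auto
    finally show ?thesis .
  qed
  have dig: "1 \<le> S k \<longleftrightarrow> c k" for k
    using S_Suc[of k] S0[of "Suc k"] S_le[of "Suc k"] by (cases "c k") auto
  have "(ternary_shift ^^ k) (S 0) = S k" for k
  proof (induction k)
    case (Suc k)
    have "ternary_shift (S k) = S (Suc k)"
      unfolding ternary_shift_def dig using S_Suc[of k] by simp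
    with Suc show ?case by simp
  qed simp
  then have "ternary_digit k (S 0) \<longleftrightarrow> c k" by (simp add: ternary_digit_def dig)
  then show ?thesis by (simp add: S_def)
qed

lemma measurable_ternary_digit[measurable]: "Measurable.pred borel (ternary_digit k)"
proof -
  have [measurable]: "ternary_shift \<in> borel_measurable borel"
    unfolding ternary_shift_def[abs_def] by measurable
  have [measurable]: "ternary_shift ^^ k \<in> borel_measurable borel" for k
    by (induction k) (auto simp: id_def comp_def)
  show ?thesis unfolding ternary_digit_def[abs_def] by measurable
qed

text \<open>A nonzero separable \<open>L\<^sup>1\<close> space is the \<open>L\<^sup>1\<close> space of a probability measure on the line. The weight \<open>w\<close> is a
normalised weighted sum of the moduli of a dense sequence \<open>F\<close>, so that every integrable function vanishes almost everywhere outside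
\<open>w > 0\<close> even if the measure is not \<open>\<sigma>\<close>-finite. The map \<open>h\<close> encodes the truth values of \<open>F n > q w\<close> for all
\<open>n\<close> and rational \<open>q\<close>; hence each quotient \<open>F n / w\<close> is a Borel function of \<open>h\<close>, which says that
\<open>lift \<circ> push\<close> fixes \<open>F n\<close>. By density it fixes everything.\<close>

lemma L1_factors_through_line:
  fixes F :: "nat \<Rightarrow> 'a \<Rightarrow> real"
  assumes F: "\<And>n. integrable M (F n)"
    and dense: "\<And>f e. integrable M f \<Longrightarrow> 0 < e \<Longrightarrow> \<exists>n. L1_nrm M (\<lambda>x. f x - F n x) < e"
    and nontriv: "integrable M f0" "L1_nrm M f0 \<noteq> 0"
  shows "\<exists>w h \<nu>. weighted_pushforward M w h \<nu> \<and> real_distribution \<nu> \<and>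
    (\<forall>f. integrable M f \<longrightarrow> (AE x in M. weighted_pushforward.lift w h
        (weighted_pushforward.push M w h \<nu> f) x = f x))"
proof -
  have [measurable]: "F n \<in> borel_measurable M" for n using F by auto
  define a where "a n = (1 / 2) ^ n / (1 + L1_nrm M (F n))" for n
  have a: "0 < a n" for n unfolding a_def by (intro divide_pos_pos add_pos_nonneg) auto
  have nrm_a: "L1_nrm M (\<lambda>x. a n * \<bar>F n x\<bar>) \<le> (1 / 2) ^ n" for n
  proof -
    have "L1_nrm M (F n) / (1 + L1_nrm M (F n)) \<le> 1"
      using L1_nrm_nonneg[of M "F n"] by (simp add: divide_le_eq add_pos_nonneg)
    then have "(1 / 2) ^ n * (L1_nrm M (F n) / (1 + L1_nrm M (F n))) \<le> (1 / 2) ^ n * 1"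
      by (intro mult_left_mono) auto
    then show ?thesis using a[of n] by (simp add: abs_mult less_imp_le a_def)
  qed
  have int_a: "integrable M (\<lambda>x. a n * \<bar>F n x\<bar>)" for n using F by auto
  have sum_a: "summable (\<lambda>n. L1_nrm M (\<lambda>x. a n * \<bar>F n x\<bar>))"
    by (rule summable_comparison_test'[of "\<lambda>n. (1 / 2) ^ n" 0]) (use nrm_a in \<open>auto intro: summable_geometric\<close>)
  \<comment> \<open>The outer absolute value guards the null set on which the series diverges.\<close>
  define w0 where "w0 x = \<bar>\<Sum>n. a n * \<bar>F n x\<bar>\<bar>" for x
  have int_w0: "integrable M w0" unfolding w0_def[abs_def]
    using L1_series(1)[OF int_a sum_a] by simp
  have w0_0: "AE x in M. w0 x = 0 \<longrightarrow> (\<forall>n. F n x = 0)"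
    using AE_summable_of_summable_nrm[OF int_a sum_a]
  proof eventually_elim
    case (elim x)
    then have s: "summable (\<lambda>n. a n * \<bar>F n x\<bar>)" by (rule summable_rabs_cancel)
    show ?case
    proof (intro impI allI)
      fix n assume "w0 x = 0"
      then have "(\<Sum>n. a n * \<bar>F n x\<bar>) = 0" by (simp add: w0_def)
      moreover have "0 \<le> a n * \<bar>F n x\<bar>" for n using a[of n] by (simp add: less_imp_le)
      ultimately have "a n * \<bar>F n x\<bar> = 0" using suminf_eq_zero_iff[OF s] by blast
      then show "F n x = 0" using a[of n] by simp
    qed
  qed
  define I where "I = (\<integral>x. w0 x \<partial>M)"
  have "I \<noteq> 0"
  proof
    assume "I = 0"
    then have "AE x in M. w0 x = 0"
      using int_w0 unfolding I_def by (subst (asm) integral_nonneg_eq_0_iff_AE) (auto simp: w0_def)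
    with w0_0 have z: "AE x in M. \<forall>n. F n x = 0" by eventually_elim simp
    obtain n where n: "L1_nrm M (\<lambda>x. f0 x - F n x) < L1_nrm M f0"
      using dense[OF nontriv(1), of "L1_nrm M f0"] nontriv(2) L1_nrm_nonneg[of M f0] by fastforce
    have "L1_nrm M (\<lambda>x. f0 x - F n x) = L1_nrm M f0"
      using z nontriv(1) F by (intro L1_nrm_cong) (auto elim!: eventually_mono)
    with n show False by simp
  qed
  moreover have "0 \<le> I" unfolding I_def by (intro Bochner_Integration.integral_nonneg) (simp add: w0_def)
  ultimately have I: "0 < I" by simp
  define w where "w x = w0 x / I" for x
  have int_w: "integrable M w" using int_w0 by (simp add: w_def[abs_def])
  then have [measurable]: "w \<in> borel_measurable M" by simp
  have w_nonneg: "0 \<le> w x" for x using I by (simp add: w_def w0_def)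
  have w_pos_iff: "w x = 0 \<longleftrightarrow> w0 x = 0" for x using I by (simp add: w_def)
  define b where "b k x \<longleftrightarrow> of_rat (from_nat (snd (prod_decode k)) :: rat) * w x < F (fst (prod_decode k)) x" for k x
  have [measurable]: "Measurable.pred M (b k)" for k unfolding b_def[abs_def] by measurable
  define h where "h x = (\<Sum>k. of_bool (b k x) * (1 / 3 :: real) ^ k)" for x
  have [measurable]: "h \<in> borel_measurable M" unfolding h_def[abs_def] by measurable
  have digit_h: "ternary_digit k (h x) \<longleftrightarrow> b k x" for k x
    unfolding h_def by (rule ternary_digit_series)
  define \<nu> where "\<nu> = distr (density M (\<lambda>x. ennreal (w x))) borel h"
  have "(\<integral>x. w x \<partial>M) = 1" using I by (simp add: w_def I_def)
  then have "(\<integral>\<^sup>+x. ennreal (w x) \<partial>M) = 1"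
    using int_w w_nonneg by (subst nn_integral_eq_integral) auto
  then have "prob_space (density M (\<lambda>x. ennreal (w x)))"
    by (intro prob_spaceI) (simp add: emeasure_density cong: nn_integral_cong)
  then have "prob_space \<nu>"
    unfolding \<nu>_def by (rule prob_space.prob_space_distr) simp
  then have \<nu>: "real_distribution \<nu>"
    by (simp add: real_distribution_def real_distribution_axioms_def \<nu>_def)
  interpret weighted_pushforward M w h \<nu>
  proof (rule weighted_pushforward.intro)
    show "finite_measure \<nu>" using \<open>prob_space \<nu>\<close> by (rule prob_space.axioms(1))
  qed (simp_all add: w_nonneg \<nu>_def[symmetric])
  interpret lift: positive_L1_map \<nu> M 1 lift by (rule positive_lift)
  interpret push: positive_L1_map M \<nu> 1 push by (rule positive_push)
  have lift_push_F: "AE x in M. lift (push (F n)) x = F n x" for n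
  proof -
    \<comment> \<open>\<open>F n x / w x\<close> is the supremum of the rationals below it, and these are read off from \<open>h x\<close>.\<close>
    define g where "g t = real_of_ereal (SUP q::rat. if ternary_digit (prod_encode (n, to_nat q)) t then ereal (of_rat q) else - \<infinity>)" for t
    have [measurable]: "g \<in> borel_measurable borel" unfolding g_def[abs_def] by measurable
    have g: "g (h x) = F n x / w x" if "0 < w x" for x
    proof -
      have "(SUP q::rat. if ternary_digit (prod_encode (n, to_nat q)) (h x) then ereal (of_rat q) else - \<infinity>)
          = ereal (F n x / w x)" (is "?S = _")
      proof (rule antisym)
        have "(if ternary_digit (prod_encode (n, to_nat q)) (h x) then ereal (of_rat q) else - \<infinity>)
            \<le> ereal (F n x / w x)" for q :: rat
          using that by (simp add: digit_h b_def field_simps)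
        then show "?S \<le> ereal (F n x / w x)" by (rule SUP_least)
        show "ereal (F n x / w x) \<le> ?S"
        proof (rule ccontr)
          assume "\<not> ereal (F n x / w x) \<le> ?S"
          then have lt: "?S < ereal (F n x / w x)" by simp
          obtain r where r: "?S < ereal r" "r < F n x / w x"
            using ereal_dense2[OF lt] by (metis ereal_less_ereal_Ex less_ereal.simps(1))
          obtain q :: rat where q: "r < of_rat q" "of_rat q < F n x / w x"
            using of_rat_dense[OF r(2)] by blast
          have "b (prod_encode (n, to_nat q)) x" using q(2) that by (simp add: b_def field_simps)
          then have q_le: "ereal (of_rat q) \<le> ?S"
            by (intro SUP_upper2[of q]) (auto simp: digit_h)
          note r(1)
          also have "ereal r < ereal (of_rat q)" using q(1) by simp
          also note q_le
          finally show False by simp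
        qed
      qed
      then show ?thesis by (simp add: g_def)
    qed
    have ae: "AE x in M. lift g x = F n x"
      using w0_0
    proof eventually_elim
      case (elim x)
      show ?case
      proof (cases "w x = 0")
        case True
        then show ?thesis using elim by (simp add: lift_def w_pos_iff)
      next
        case False
        then have "0 < w x" using w_nonneg[of x] by simp
        then show ?thesis by (simp add: lift_def g)
      qed
    qed
    have ilg: "integrable M (lift g)"
    proof (rule integrable_cong_AE_imp[OF F])
      show "lift g \<in> borel_measurable M" unfolding lift_def[abs_def] by measurable
      show "AE x in M. F n x = lift g x" using ae by eventually_elim simp
    qed
    then have ig: "integrable \<nu> g" by (simp add: integrable_lift_iff)
    have "AE y in \<nu>. push (F n) y = push (lift g) y"
      using ae by (intro push.cong F ilg) (auto elim: eventually_mono)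
    with push_lift[OF ig] have "AE y in \<nu>. push (F n) y = g y" by eventually_elim simp
    then have "AE x in M. lift (push (F n)) x = lift g x"
      by (intro lift.cong push.int F ig)
    with ae show ?thesis by eventually_elim simp
  qed
  have "AE x in M. lift (push f) x = f x" if f: "integrable M f" for f
  proof -
    let ?d = "\<lambda>x. lift (push f) x - f x"
    have ilp: "integrable M (lift (push u))" if "integrable M u" for u
      by (intro lift.int push.int that)
    have d: "integrable M ?d" using ilp[OF f] f by auto
    have "L1_nrm M ?d \<le> e" if e: "0 < e" for e
    proof -
      obtain n where n: "L1_nrm M (\<lambda>x. f x - F n x) < e / 2" using dense[OF f, of "e / 2"] e by auto
      let ?u = "\<lambda>x. f x - F n x"
      have u: "integrable M ?u" using f F by auto
      have "AE y in \<nu>. push ?u y = push f y - push (F n) y" by (rule push.diff[OF f F])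
      then have "AE x in M. lift (push ?u) x = lift (\<lambda>y. push f y - push (F n) y) x"
        using push.int[OF f] push.int[OF F[of n]] by (intro lift.cong push.int u) auto
      moreover have "AE x in M. lift (\<lambda>y. push f y - push (F n) y) x = lift (push f) x - lift (push (F n)) x"
        by (intro lift.diff push.int f F)
      ultimately have "AE x in M. ?d x = lift (push ?u) x + (-1) * ?u x"
        using lift_push_F[of n] by eventually_elim simp
      then have "L1_nrm M ?d = L1_nrm M (\<lambda>x. lift (push ?u) x + (-1) * ?u x)"
        by (intro L1_nrm_cong Bochner_Integration.integrable_add integrable_mult_right d ilp u)
      also have "\<dots> \<le> L1_nrm M (lift (push ?u)) + L1_nrm M (\<lambda>x. (-1) * ?u x)"
        using ilp[OF u] f F by (intro L1_nrm_triangle) auto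
      also have "L1_nrm M (\<lambda>x. (-1) * ?u x) = L1_nrm M ?u" by (simp add: abs_minus_commute)
      also have "L1_nrm M (lift (push ?u)) \<le> L1_nrm M ?u"
        using lift.bound[OF push.int[OF u]] push.bound[OF u] by simp
      finally show ?thesis using n by simp
    qed
    then have "L1_nrm M ?d \<le> 0" by (rule field_le_epsilon[of _ 0, simplified])
    then have "L1_nrm M ?d = 0" using L1_nrm_nonneg[of M ?d] by linarith
    then have "AE x in M. ?d x = 0" by (simp only: L1_nrm_eq_0_iff[OF d])
    then show ?thesis by eventually_elim simp
  qed
  with \<nu> weighted_pushforward_axioms show ?thesis by blast
qed

lemma dense_sequence_of_L1_separable:
  assumes "L1_separable M"
  shows "\<exists>F :: nat \<Rightarrow> 'a \<Rightarrow> real. (\<forall>n. integrable M (F n)) \<and>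
    (\<forall>f e. integrable M f \<longrightarrow> 0 < e \<longrightarrow> (\<exists>n. L1_nrm M (\<lambda>x. f x - F n x) < e))"
proof -
  interpret L: Metric_space "L1 M" "L1_dist M" by (rule Metric_space_L1)
  obtain X where X: "countable X" "X \<subseteq> L1 M" "L.mtopology closure_of X = L1 M"
    using assms unfolding L1_separable_def L1_topology_def separable_space_def L.topspace_mtopology
    by blast
  have near: "\<exists>v\<in>X. L1_dist M u v < e" if "u \<in> L1 M" "0 < e" for u e
  proof -
    have "u \<in> L.mtopology closure_of X" using X(3) that(1) by simp
    then show ?thesis using that(2) unfolding L.metric_closure_of by auto
  qed
  have "X \<noteq> {}" using near[OF L1_zero_in, of 1] by auto
  define F where "F n = L1_rep (from_nat_into X n)" for n
  show ?thesis
  proof (intro exI[of _ F] conjI allI impI)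
    show "integrable M (F n)" for n
      unfolding F_def using X(2) from_nat_into[OF \<open>X \<noteq> {}\<close>] by (intro L1_rep(1)) auto
    fix f :: "'a \<Rightarrow> real" and e :: real assume f: "integrable M f" and e: "0 < e"
    obtain v where v: "v \<in> X" "L1_dist M (L1_class M f) v < e"
      using near[OF L1_class_in[OF f] e] by blast
    obtain n where n: "v = from_nat_into X n" using from_nat_into_surj[OF X(1) v(1)] by blast
    have vL: "v \<in> L1 M" using v(1) X(2) by auto
    have "L1_dist M (L1_class M f) (L1_class M (L1_rep v)) = L1_nrm M (\<lambda>x. f x - L1_rep v x)"
      using f L1_rep(1)[OF vL] by (simp add: L1_dist_def L1_diff_class L1_norm_class)
    then have "L1_dist M (L1_class M f) v = L1_nrm M (\<lambda>x. f x - F n x)"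
      using L1_rep(2)[OF vL] by (simp add: F_def n[symmetric])
    with v(2) show "\<exists>n. L1_nrm M (\<lambda>x. f x - F n x) < e" by auto
  qed
qed

lemma nonzero_of_L1_infinite_dimensional:
  assumes "L1_infinite_dimensional M"
  shows "\<exists>f. integrable M f \<and> L1_nrm M f \<noteq> 0"
proof (rule ccontr)
  assume "\<not> ?thesis"
  then have z: "L1_nrm M f = 0" if "integrable M f" for f using that by blast
  have "u = L1_lincomb M (\<lambda>_. 0) {}" if u: "u \<in> L1 M" for u
  proof -
    obtain f where f: "integrable M f" "u = L1_class M f" using u by (rule L1_cases)
    then show ?thesis using z[OF f(1)]
      by (simp add: L1_lincomb_empty L1_zero_def L1_class_eq_iff L1_nrm_eq_0_iff)
  qed
  then have "finite {} \<and> {} \<subseteq> L1 M \<and> (\<forall>u\<in>L1 M. \<exists>c. u = L1_lincomb M c {})" by auto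
  with assms show False unfolding L1_infinite_dimensional_def by blast
qed

text \<open>If \<open>\<nu>\<close> lived on a finite set \<open>S\<close>, the functions on the fibres of \<open>\<phi>\<close> over the points of \<open>S\<close> would span.\<close>

lemma (in weighted_pushforward) infinite_support_of_L1_infinite_dimensional:
  assumes surj: "\<And>f. integrable M f \<Longrightarrow> AE x in M. lift (push f) x = f x"
    and inf: "L1_infinite_dimensional M" and S: "finite S"
  shows "\<not> (AE y in \<nu>. y \<in> S)"
proof
  assume "AE y in \<nu>. y \<in> S"
  moreover have "S \<in> sets borel" using S by (intro borel_closed finite_imp_closed)
  then have "Measurable.pred borel (\<lambda>y. y \<in> S)" by measurable
  ultimately have AE_S: "AE x in M. 0 < w x \<longrightarrow> \<phi> x \<in> S" by (simp add: AE_\<nu>_iff)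
  interpret \<nu>: finite_measure \<nu> by (rule finite_\<nu>)
  define E where "E s = L1_class M (lift (indicator {s}))" for s
  have int_E: "integrable M (lift (indicator {s}))" for s
    by (subst integrable_lift_iff) (auto simp: \<nu>.emeasure_finite less_top[symmetric])
  have span: "\<exists>c. u = L1_lincomb M c (E ` S)" if u: "u \<in> L1 M" for u
  proof -
    define f where "f = L1_rep u"
    have f: "integrable M f" "L1_class M f = u" using L1_rep[OF u] by (simp_all add: f_def)
    define g where "g = push f"
    \<comment> \<open>Points of measure zero all give the zero class, so coefficients are collected by class.\<close>
    define c where "c v = (\<Sum>s\<in>{s\<in>S. E s = v}. g s)" for v
    have lin: "(\<Sum>v\<in>E ` S. c v * L1_rep v x) = (\<Sum>s\<in>S. g s * L1_rep (E s) x)" for x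
    proof -
      have "(\<Sum>s\<in>S. g s * L1_rep (E s) x) = (\<Sum>v\<in>E ` S. \<Sum>s\<in>{s\<in>S. E s = v}. g s * L1_rep (E s) x)"
        by (rule sum.image_gen[OF S])
      also have "\<dots> = (\<Sum>v\<in>E ` S. c v * L1_rep v x)"
        unfolding c_def sum_distrib_right by (intro sum.cong) auto
      finally show ?thesis by simp
    qed
    have "AE x in M. \<forall>s\<in>S. L1_rep (E s) x = lift (indicator {s}) x"
      using S L1_rep_class(2)[OF int_E] by (simp add: AE_finite_all E_def)
    with AE_S surj[OF f(1)] have "AE x in M. f x = (\<Sum>v\<in>E ` S. c v * L1_rep v x)"
    proof eventually_elim
      case (elim x)
      have "(\<Sum>s\<in>S. g s * (w x * indicator {s} (\<phi> x))) = w x * g (\<phi> x)"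
      proof (cases "w x = 0")
        case False
        then have "\<phi> x \<in> S" using elim(1) w_nonneg[of x] by auto
        have "(\<Sum>s\<in>S. g s * (w x * indicator {s} (\<phi> x))) = (\<Sum>s\<in>S. if s = \<phi> x then g s * w x else 0)"
          by (intro sum.cong) (auto simp: indicator_def)
        also have "\<dots> = g (\<phi> x) * w x" using \<open>\<phi> x \<in> S\<close> S by simp
        finally show ?thesis by simp
      qed simp
      with elim(2,3) show ?case unfolding lin by (simp add: lift_def g_def)
    qed
    moreover have "integrable M (\<lambda>x. \<Sum>v\<in>E ` S. c v * L1_rep v x)"
      unfolding lin using L1_rep_class(1)[OF int_E]
      by (intro Bochner_Integration.integrable_sum integrable_mult_right) (simp add: E_def)
    ultimately have "L1_class M f = L1_lincomb M c (E ` S)"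
      unfolding L1_lincomb_def using f(1) by (simp add: L1_class_eq_iff)
    then show ?thesis using f(2) by auto
  qed
  have "finite (E ` S)" "E ` S \<subseteq> L1 M" using S int_E by (auto simp: E_def L1_class_in)
  with span have "\<exists>T. finite T \<and> T \<subseteq> L1 M \<and> (\<forall>u\<in>L1 M. \<exists>c. u = L1_lincomb M c T)"
    by (intro exI[of _ "E ` S"]) simp
  with inf show False by (simp add: L1_infinite_dimensional_def)
qed

lemma weighted_pushforward_through:
  assumes h: "weighted_pushforward M w h \<nu>"
    and [measurable]: "v \<in> borel_measurable borel" "\<psi> \<in> borel_measurable borel"
    and v0: "\<And>y. 0 \<le> v y" and eq: "distr (density \<nu> (\<lambda>y. ennreal (v y))) borel \<psi> = \<nu>"
  shows "weighted_pushforward M (\<lambda>x. w x * v (h x)) (\<lambda>x. \<psi> (h x)) \<nu>"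
proof -
  interpret weighted_pushforward M w h \<nu> by fact
  show ?thesis
  proof (rule weighted_pushforward.intro)
    have "distr (density M (\<lambda>x. ennreal (w x * v (h x)))) borel (\<lambda>x. \<psi> (h x))
        = distr (density (density M (\<lambda>x. ennreal (w x))) (\<lambda>x. ennreal (v (h x)))) borel (\<lambda>x. \<psi> (h x))"
      by (subst density_density_eq) (auto simp: ennreal_mult' w_nonneg)
    also have "\<dots> = distr (distr (density (density M (\<lambda>x. ennreal (w x))) (\<lambda>x. ennreal (v (h x)))) borel h) borel \<psi>"
      by (subst distr_distr) (auto simp: comp_def)
    also have "distr (density (density M (\<lambda>x. ennreal (w x))) (\<lambda>x. ennreal (v (h x)))) borel h
        = density \<nu> (\<lambda>y. ennreal (v y))"
      unfolding \<nu>_eq[symmetric] by (subst density_distr) auto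
    finally show "distr (density M (\<lambda>x. ennreal (w x * v (h x)))) borel (\<lambda>x. \<psi> (h x)) = \<nu>"
      by (simp only: eq)
  qed (use w_nonneg v0 finite_\<nu> in auto)
qed

text \<open>Each of the sets \<open>D n\<close> on the line is pulled back to \<open>M\<close>. Through the reweighted map onto \<open>\<nu>\<close>, its
\<open>L\<^sup>1\<close> space contains a complemented copy of \<open>L\<^sup>1(\<nu>)\<close>, which is the whole of \<open>L\<^sup>1(M)\<close>.\<close>

lemma disjoint_complemented_copies:
  assumes "L1_separable M" "L1_infinite_dimensional M"
  shows "\<exists>D J Q. (\<forall>n::nat. D n \<in> sets M) \<and> disjoint_family D \<and>
    (\<forall>n. positive_L1_map M M 1 (J n)) \<and> (\<forall>n. positive_L1_map M M 1 (Q n)) \<and>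
    (\<forall>n f. integrable M f \<longrightarrow> (AE x in M. Q n (band (D n) (J n f)) x = f x))"
proof -
  obtain F :: "nat \<Rightarrow> 'a \<Rightarrow> real" where F: "\<And>n. integrable M (F n)"
    "\<And>f e. integrable M f \<Longrightarrow> 0 < e \<Longrightarrow> \<exists>n. L1_nrm M (\<lambda>x. f x - F n x) < e"
    using dense_sequence_of_L1_separable[OF assms(1)] by blast
  obtain f0 where "integrable M f0" "L1_nrm M f0 \<noteq> 0"
    using nonzero_of_L1_infinite_dimensional[OF assms(2)] by blast
  from L1_factors_through_line[OF F this]
  obtain w h \<nu> where W: "weighted_pushforward M w h \<nu>" and \<nu>: "real_distribution \<nu>"
    and surj: "\<And>f. integrable M f \<Longrightarrow> AE x in M. weighted_pushforward.lift w h
        (weighted_pushforward.push M w h \<nu> f) x = f x" by blast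
  interpret W: weighted_pushforward M w h \<nu> by (rule W)
  have "spreadable \<nu>"
    by (rule spreadable_of_infinite_support[OF \<nu>
        W.infinite_support_of_L1_infinite_dimensional[OF surj assms(2)]])
  then obtain D v \<psi> where D: "disjoint_family (D :: nat \<Rightarrow> real set)" "\<And>n. D n \<in> sets borel"
    and v: "\<And>n. v n \<in> borel_measurable borel" "\<And>n y. 0 \<le> (v n y :: real)" "\<And>n y. y \<notin> D n \<Longrightarrow> v n y = 0"
    and \<psi>: "\<And>n. \<psi> n \<in> borel_measurable borel"
      "\<And>n. distr (density \<nu> (\<lambda>y. ennreal (v n y))) borel (\<psi> n) = \<nu>"
    unfolding spreadable_def by blast
  interpret V: weighted_pushforward M "\<lambda>x. w x * v n (h x)" "\<lambda>x. \<psi> n (h x)" \<nu> for n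
    by (rule weighted_pushforward_through[OF W v(1) \<psi>(1) v(2) \<psi>(2)])
  define DD where "DD n = h -` D n \<inter> space M" for n
  define J where "J n f = V.lift n (W.push f)" for n f
  define Q where "Q n f = W.lift (V.push n f)" for n f
  have J: "positive_L1_map M M 1 (J n)" for n
    using positive_L1_map_comp[OF W.positive_push V.positive_lift[of n]] by (simp add: J_def[abs_def])
  have Q: "positive_L1_map M M 1 (Q n)" for n
    using positive_L1_map_comp[OF V.positive_push[of n] W.positive_lift] by (simp add: Q_def[abs_def])
  have DD: "DD n \<in> sets M" for n
    unfolding DD_def using measurable_sets[OF W.\<phi>_meas D(2)] .
  have QJ: "AE x in M. Q n (band (DD n) (J n f)) x = f x" if f: "integrable M f" for n f
  proof -
    interpret Qn: positive_L1_map M M 1 "Q n" by (rule Q)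
    interpret L: positive_L1_map \<nu> M 1 W.lift by (rule W.positive_lift)
    have Jf: "integrable M (J n f)" by (rule positive_L1_map.int[OF J f])
    have pf: "integrable \<nu> (W.push f)" by (rule positive_L1_map.int[OF W.positive_push f])
    have "AE x in M. Q n (band (DD n) (J n f)) x = Q n (J n f) x"
    proof (rule Qn.cong[OF integrable_band[OF DD Jf] Jf], rule AE_I2)
      fix x assume "x \<in> space M"
      then show "band (DD n) (J n f) x = J n f x"
        unfolding J_def by (intro V.band_lift) (auto simp: DD_def v(3))
    qed
    moreover have "AE x in M. Q n (J n f) x = W.lift (W.push f) x"
      unfolding Q_def
    proof (rule L.cong[OF _ pf])
      show "integrable \<nu> (V.push n (J n f))" by (rule positive_L1_map.int[OF V.positive_push Jf])
      show "AE y in \<nu>. V.push n (J n f) y = W.push f y"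
        unfolding J_def by (rule V.push_lift[OF pf])
    qed
    ultimately show ?thesis using surj[OF f] by eventually_elim simp
  qed
  have disj: "disjoint_family DD" using D(1) unfolding disjoint_family_on_def DD_def by blast
  show ?thesis
  proof (rule exI[of _ DD], rule exI[of _ J], rule exI[of _ Q], intro conjI allI impI)
    show "AE x in M. Q n (band (DD n) (J n f)) x = f x" if "integrable M f" for n f
      by (rule QJ[OF that])
  qed (rule DD J Q disj)+
qed

section \<open>From functions to classes\<close>

lemma positive_L1_map_of_operator:
  assumes "L1_positive_operator M C"
  shows "\<exists>c\<ge>0. positive_L1_map M M c (\<lambda>f. L1_rep (C (L1_class M f)))"
proof -
  have op: "L1_operator M C" and pos: "\<And>u. u \<in> L1 M \<Longrightarrow> L1_le M (L1_zero M) u \<Longrightarrow> L1_le M (L1_zero M) (C u)"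
    using assms by (auto simp: L1_positive_operator_def)
  have C_in: "\<And>u. u \<in> L1 M \<Longrightarrow> C u \<in> L1 M"
    and C_add: "\<And>u v. u \<in> L1 M \<Longrightarrow> v \<in> L1 M \<Longrightarrow> C (L1_add M u v) = L1_add M (C u) (C v)"
    and C_scale: "\<And>a u. u \<in> L1 M \<Longrightarrow> C (L1_scale M a u) = L1_scale M a (C u)"
    using op by (auto simp: L1_operator_def)
  obtain K where K: "\<And>u. u \<in> L1 M \<Longrightarrow> L1_norm M (C u) \<le> K * L1_norm M u"
    using op unfolding L1_operator_def by blast
  let ?T = "\<lambda>f. L1_rep (C (L1_class M f))"
  have T_int: "integrable M (?T f)" if "integrable M f" for f
    by (rule L1_rep(1)[OF C_in[OF L1_class_in[OF that]]])
  have "positive_L1_map M M (max 0 K) ?T"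
  proof
    fix f g :: "'a \<Rightarrow> real" and a assume f: "integrable M f"
    note u = L1_class_in[OF f] and Cu = C_in[OF L1_class_in[OF f]]
    show "integrable M (?T f)" by (rule T_int[OF f])
    have "L1_nrm M (?T f) \<le> K * L1_nrm M f"
      using K[OF u] by (simp add: L1_norm_class[OF f]) (simp add: L1_norm_def)
    also have "\<dots> \<le> max 0 K * L1_nrm M f" by (intro mult_right_mono) auto
    finally show "L1_nrm M (?T f) \<le> max 0 K * L1_nrm M f" .
    have "C (L1_class M (\<lambda>x. a * f x)) = L1_class M (\<lambda>x. a * ?T f x)"
      using C_scale[OF u, of a] by (simp add: L1_scale_class[OF f]) (simp add: L1_scale_def)
    then show "AE x in M. ?T (\<lambda>x. a * f x) x = a * ?T f x"
      using L1_rep_class(2)[OF integrable_mult_right[OF T_int[OF f], of a]] by simp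
    show "AE x in M. 0 \<le> ?T f x" if "AE x in M. 0 \<le> f x"
    proof -
      have "L1_le M (L1_zero M) (L1_class M f)"
        using that f by (simp add: L1_zero_def L1_le_class)
      then have "L1_le M (L1_zero M) (L1_class M (?T f))"
        using pos[OF u] L1_rep(2)[OF Cu] by simp
      then show ?thesis using T_int[OF f] by (simp add: L1_zero_def L1_le_class)
    qed
    assume g: "integrable M g"
    have "C (L1_class M (\<lambda>x. f x + g x)) = L1_class M (\<lambda>x. ?T f x + ?T g x)"
      using C_add[OF u L1_class_in[OF g]] by (simp add: L1_add_class[OF f g]) (simp add: L1_add_def)
    then show "AE x in M. ?T (\<lambda>x. f x + g x) x = ?T f x + ?T g x"
      using L1_rep_class(2)[OF Bochner_Integration.integrable_add[OF T_int[OF f] T_int[OF g]]] by simp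
  qed
  then show ?thesis by (intro exI[of _ "max 0 K"] conjI) simp_all
qed

lemma operator_of_positive_L1_map:
  assumes "positive_L1_map M M c T"
  shows "L1_positive_operator M (\<lambda>u. L1_class M (T (L1_rep u)))" (is "L1_positive_operator M ?O")
    and "\<And>f. integrable M f \<Longrightarrow> L1_class M (T (L1_rep (L1_class M f))) = L1_class M (T f)"
proof -
  interpret positive_L1_map M M c T by fact
  show O: "L1_class M (T (L1_rep (L1_class M f))) = L1_class M (T f)" if "integrable M f" for f
    using that L1_rep_class[OF that] by (simp add: L1_class_eq_iff int cong)
  show "L1_positive_operator M ?O"
    unfolding L1_positive_operator_def L1_operator_def
  proof (intro conjI ballI allI impI exI[of _ c] funcsetI)
    fix u assume u: "u \<in> L1 M"
    then obtain f where f: "integrable M f" "u = L1_class M f" by (rule L1_cases)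
    show "?O u \<in> L1 M" using f by (simp add: O L1_class_in int)
    show "L1_norm M (?O u) \<le> c * L1_norm M u"
      using f bound by (simp add: O L1_norm_class int)
    show "?O (L1_scale M a u) = L1_scale M a (?O u)" for a
      using f scale by (simp add: O L1_scale_class int L1_class_eq_iff)
    show "L1_le M (L1_zero M) (?O u)" if "L1_le M (L1_zero M) u"
      using that f pos by (simp add: O L1_zero_def L1_le_class int)
    fix v assume "v \<in> L1 M"
    then obtain g where g: "integrable M g" "v = L1_class M g" by (rule L1_cases)
    show "?O (L1_add M u v) = L1_add M (?O u) (?O v)"
      using f g add by (simp add: O L1_add_class int L1_class_eq_iff)
  qed
qed

lemma finite_net_of_L1_compact_operator:
  assumes "L1_compact_operator M C" and e: "0 < e"
  shows "\<exists>G. finite G \<and> (\<forall>g\<in>G. integrable M g) \<and>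
        (\<forall>f. integrable M f \<longrightarrow> L1_nrm M f \<le> 1 \<longrightarrow>
          (\<exists>g\<in>G. L1_nrm M (\<lambda>x. L1_rep (C (L1_class M f)) x - g x) \<le> e))"
proof -
  interpret L: Metric_space "L1 M" "L1_dist M" by (rule Metric_space_L1)
  define B where "B = C ` {u \<in> L1 M. L1_norm M u \<le> 1}"
  have C_in: "C u \<in> L1 M" if "u \<in> L1 M" for u
    using assms(1) that by (auto simp: L1_compact_operator_def L1_operator_def)
  have "compactin L.mtopology (L.mtopology closure_of B)"
    using assms(1) by (simp add: L1_compact_operator_def L1_topology_def B_def)
  then have "L.mtotally_bounded (L.mtopology closure_of B)" by (rule L.compactin_imp_mtotally_bounded)
  then obtain N where N: "finite N" "N \<subseteq> L.mtopology closure_of B"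
    "L.mtopology closure_of B \<subseteq> (\<Union>v\<in>N. L.mball v e)"
    using e by (auto simp only: L.mtotally_bounded_def)
  have B_sub: "B \<subseteq> L.mtopology closure_of B"
    by (rule closure_of_subset) (auto simp: B_def C_in)
  have N_in: "N \<subseteq> L1 M" using N(2) closure_of_subset_topspace[of L.mtopology B] by auto
  show ?thesis
  proof (intro exI[of _ "L1_rep ` N"] conjI ballI allI impI)
    fix f assume f: "integrable M f" "L1_nrm M f \<le> 1"
    let ?u = "C (L1_class M f)"
    have u: "?u \<in> L1 M" by (intro C_in L1_class_in f)
    have "?u \<in> B" unfolding B_def using f by (auto simp: L1_norm_class L1_class_in)
    then obtain v where v: "v \<in> N" "?u \<in> L.mball v e" using N(3) B_sub by blast
    have vL: "v \<in> L1 M" using v(1) N_in by auto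
    have "L1_dist M ?u v < e" using v(2) by (simp add: L.commute)
    moreover have "L1_dist M ?u v = L1_nrm M (\<lambda>x. L1_rep ?u x - L1_rep v x)"
      using L1_rep(1)[OF u] L1_rep(1)[OF vL]
      by (simp add: L1_dist_def L1_diff_def L1_norm_class)
    ultimately show "\<exists>g\<in>L1_rep ` N. L1_nrm M (\<lambda>x. L1_rep ?u x - g x) \<le> e"
      using v(1) by (auto intro!: bexI[of _ v])
  next
    fix g assume "g \<in> L1_rep ` N"
    then show "integrable M g" using N_in L1_rep(1) by auto
  qed (use N in auto)
qed

theorem corollary5p6:
  fixes M :: "'a measure"
    and C :: "('a \<Rightarrow> real) set \<Rightarrow> ('a \<Rightarrow> real) set"
  assumes "L1_separable M"
    and "L1_infinite_dimensional M"
    and "L1_compact_operator M C"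
    and "L1_positive_operator M C"
  shows "\<exists>A B. L1_positive_operator M A \<and> L1_positive_operator M B \<and>
           (\<forall>u\<in>L1 M. C u = L1_diff M (A (B u)) (B (A u)))"
proof -
  let ?C = "\<lambda>f. L1_rep (C (L1_class M f))"
  obtain c where c: "0 \<le> c" and C: "positive_L1_map M M c ?C"
    using positive_L1_map_of_operator[OF assms(4)] by blast
  obtain D J Q where D: "\<And>n::nat. D n \<in> sets M" "disjoint_family D"
    and J: "\<And>n. positive_L1_map M M 1 (J n)" and Q: "\<And>n. positive_L1_map M M 1 (Q n)"
    and QJ: "\<And>n f. integrable M f \<Longrightarrow> AE x in M. Q n (band (D n) (J n f)) x = f x"
    using disjoint_complemented_copies[OF assms(1,2)] by blast
  note small = tail_small_of_precompact[OF D C finite_net_of_L1_compact_operator[OF assms(3)]]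
  obtain A B a b where A: "positive_L1_map M M a A" and B: "positive_L1_map M M b B"
    and AB: "\<And>f. integrable M f \<Longrightarrow> AE x in M. ?C f x = A (B f) x - B (A f) x"
    using commutator_of_tail_small[OF D J Q QJ C c small] by blast
  let ?A = "\<lambda>u. L1_class M (A (L1_rep u))" and ?B = "\<lambda>u. L1_class M (B (L1_rep u))"
  note iA = positive_L1_map.int[OF A] and iB = positive_L1_map.int[OF B]
  note A' = operator_of_positive_L1_map[OF A] and B' = operator_of_positive_L1_map[OF B]
  have "C u = L1_diff M (?A (?B u)) (?B (?A u))" if u: "u \<in> L1 M" for u
  proof -
    obtain f where f: "integrable M f" "u = L1_class M f" using u by (rule L1_cases)
    have Cu: "C u \<in> L1 M"
      using assms(4) u by (auto simp: L1_positive_operator_def L1_operator_def)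
    have "C u = L1_class M (?C f)" using L1_rep(2)[OF Cu] f(2) by simp
    also have "\<dots> = L1_class M (\<lambda>x. A (B f) x - B (A f) x)"
      using AB[OF f(1)] positive_L1_map.int[OF C f(1)] f(1) by (simp add: L1_class_eq_iff iA iB)
    also have "\<dots> = L1_diff M (L1_class M (A (B f))) (L1_class M (B (A f)))"
      using f(1) by (simp add: L1_diff_class iA iB)
    also have "\<dots> = L1_diff M (?A (?B u)) (?B (?A u))"
      unfolding f(2) using f(1) by (simp add: A'(2) B'(2) iA iB)
    finally show ?thesis .
  qed
  with A'(1) B'(1) show ?thesis by blast
qed

end
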